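(* Let $p_\infty$ be a polarization of $\mathbb{A}^3$ and let $C\subset\mathbb{R}^3$ be a proper convex cone whose projectivization $\mathbb{P}(C)\subset P_\infty$ contains $p_\infty$. Then the set $$\mathcal{S}_C:=\{C\text{-spacelike planes in }\mathbb{A}^3\}$$ is a convex tube domain in the dual polarized affine space $\mathbb{A}^{3*}$, whose underlying planar convex domain is (projectively identified with) a section of the dual cone $C^*$. The natural action of $\mathrm{Aut}(C)\ltimes\mathbb{R}^3$ on $\mathcal{S}_C$ induces an isomorphism between $\mathrm{Aut}(C)\ltimes\mathbb{R}^3$ and the automorphism group of $\mathcal{S}_C$ as a convex tube domain.
   Context: $\mathbb{A}^3$ is the real affine space with underlying vector space $\mathbb{R}^3$, viewed as an affine chart of $\mathbb{RP}^3$. Its plane at infinity is $P_\infty:=\mathbb{RP}^3\setminus\mathbb{A}^3\cong\mathbb{P}(\mathbb{R}^3)=\mathbb{RP}^2$. A polarization of $\mathbb{A}^3$ is a choice of a point $p_\infty\in P_\infty$. The dual polarized affine space $\mathbb{A}^{3*}$ is the set of affine planes in $\mathbb{A}^3$ not containing $p_\infty$ at infinity; it is an affine chart of the dual projective space $\mathbb{RP}^{3*}=\{\text{affine planes in }\mathbb{A}^3\}\cup\{P_\infty\}$, and it is polarized by the point $P_\infty\in\mathbb{RP}^{3*}\setminus\mathbb{A}^{3*}$. A convex cone is a convex domain (nonempty open convex set) in $\mathbb{R}^3$ invariant under positive scalings; it is proper if it contains no entire line. Its dual cone $C^*\subset\mathbb{R}^{3*}$ is the set of linear forms positive on $\overline{C}\setminus\{0\}$.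 $\mathrm{Aut}(C)<\mathrm{SL}(3,\mathbb{R})$ is the subgroup preserving $C$, and $(A,X)\in\mathrm{Aut}(C)\ltimes\mathbb{R}^3$ acts on $\mathbb{A}^3$ by $Y\mapsto AY+X$. An affine plane in $\mathbb{A}^3$ is $C$-spacelike if its underlying vector subspace meets $\overline{C}$ only at $0$. A convex tube domain in a polarized affine $3$-space is a subset which, in some affine coordinates $\mathbb{R}^3=\mathbb{R}^2\times\mathbb{R}$ in which the polarization is the point at infinity of the vertical lines $\{x\}\times\mathbb{R}$, has the form $T=\Omega\times\mathbb{R}$ with $\Omega\subset\mathbb{R}^2$ a bounded convex domain; $\Omega$ is the underlying planar convex domain. A projective transformation $\Phi\in\mathrm{PGL}(4,\mathbb{R})$ preserving $T$ fixes the point $p_T$ at infinity of the vertical lines and permutes the vertical lines in $T$, hence induces a projective transformation $\pi(\Phi)$ of $\Omega$. $\Phi$ is an automorphism of $T$ if it preserves $T$ and: (i) $\Phi$ maps vertical lines to vertical lines preserving the upward orientation; (ii) $\pi(\Phi)$ is orientation-preserving on $\Omega$; (iii) the eigenvalue at $p_T$ of a representative of $\Phi$ in $\mathrm{GL}(4,\mathbb{R})$ with determinant $\pm1$ is $\pm1$. *)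

theory Defs
  imports "HOL-Analysis.Analysis" "HOL-Algebra.Bij"
begin

section \<open>Projective spaces and projective transformations\<close>

definition projective_space :: "(real^'n) set set" where
  "projective_space = {l. subspace l \<and> dim l = 1}"

definition projectivization :: "(real^'n) set \<Rightarrow> (real^'n) set set" where
  "projectivization S = {span {x} |x. x \<in> S}"

definition affine_chart :: "(real^'n) set \<Rightarrow> (real^'n) set set" where
  "affine_chart E = {l \<in> projective_space. \<not> l \<subseteq> E}"

definition proj_map :: "real^'n^'n \<Rightarrow> (real^'n) set \<Rightarrow> (real^'n) set" where
  "proj_map A = (\<lambda>l \<in> projective_space. ((*v) A) ` l)"

definition homographies :: "((real^'n) set \<Rightarrow> (real^'n) set) set" where
  "homographies = {proj_map A |A. invertible A}"


section \<open>Affine space, its planes, and the dual projective space\<close>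

definition homog :: "real^3 \<Rightarrow> real \<Rightarrow> real^4" where
  "homog Y t = vector [Y$1, Y$2, Y$3, t]"

definition affine_plane :: "(real^3) set \<Rightarrow> bool" where
  "affine_plane H \<longleftrightarrow> affine H \<and> aff_dim H = 2"

definition direction :: "(real^3) set \<Rightarrow> (real^3) set" where
  "direction H = {Y - Z |Y Z. Y \<in> H \<and> Z \<in> H}"

text \<open>
  A polarization \<open>p\<close> is a point of \<open>projective_space :: (real^3) set set\<close>, the plane at infinity.
  A plane \<open>H\<close> contains it at infinity iff the line \<open>p\<close> lies in \<open>direction H\<close>.
\<close>

definition dual_affine_space :: "(real^3) set \<Rightarrow> (real^3) set set" where
  "dual_affine_space p = {H. affine_plane H \<and> \<not> p \<subseteq> direction H}"

text \<open>
  A vector \<open>u\<close> of \<open>real^4\<close> also stands for the linear form \<open>\<lambda>v. u \<bullet> v\<close>, so \<open>projective_space\<close> over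
  \<open>real^4\<close> serves as the dual projective space. A projective plane corresponds to the line of
  linear forms vanishing on it; \<open>dual_point H\<close> is this line for the projective completion of the
  affine plane \<open>H\<close>, and \<open>dual_point_infinity\<close> is the one of the plane at infinity.
  The planes through the point at infinity \<open>p\<close>, including the plane at infinity itself, form the
  projectivization of the hyperplane \<open>dual_hyperplane p\<close>.
\<close>

definition dual_point :: "(real^3) set \<Rightarrow> (real^4) set" where
  "dual_point H = {u. \<forall>Y\<in>H. u \<bullet> homog Y 1 = 0}"

definition dual_point_infinity :: "(real^4) set" where
  "dual_point_infinity = {u. \<forall>v. u \<bullet> homog v 0 = 0}"

definition dual_hyperplane :: "(real^3) set \<Rightarrow> (real^4) set" where
  "dual_hyperplane p = {u. \<forall>v\<in>p. u \<bullet> homog v 0 = 0}"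


section \<open>Convex cones and spacelike planes\<close>

definition proper_convex_cone :: "(real^3) set \<Rightarrow> bool" where
  "proper_convex_cone C \<longleftrightarrow>
     open C \<and> convex C \<and> C \<noteq> {} \<and> (\<forall>x\<in>C. \<forall>t>0. t *\<^sub>R x \<in> C) \<and>
     \<not> (\<exists>x v. v \<noteq> 0 \<and> (\<forall>t. x + t *\<^sub>R v \<in> C))"

text \<open>Linear forms on \<open>real^3\<close> are represented by vectors through the inner product.\<close>

definition dual_cone :: "(real^3) set \<Rightarrow> (real^3) set" where
  "dual_cone C = {a. \<forall>x \<in> closure C - {0}. a \<bullet> x > 0}"

text \<open>
  Requiring \<open>w\<close> to be positive on the nonzero points of the closure of \<open>K\<close> makes the affine plane
  \<open>w \<bullet> a = 1\<close> meet every ray of \<open>K\<close>, in a bounded set.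
\<close>

definition section_of :: "(real^3) set \<Rightarrow> (real^3) set \<Rightarrow> bool" where
  "section_of K \<Sigma> \<longleftrightarrow> (\<exists>w \<in> dual_cone K. \<Sigma> = {a \<in> K. w \<bullet> a = 1})"

definition spacelike_planes :: "(real^3) set \<Rightarrow> (real^3) set set" where
  "spacelike_planes C = {H. affine_plane H \<and> direction H \<inter> closure C = {0}}"

definition Aut_cone :: "(real^3) set \<Rightarrow> (real^3^3) set" where
  "Aut_cone C = {A. det A = 1 \<and> ((*v) A) ` C = C}"

definition affine_action :: "(real^3^3) \<times> (real^3) \<Rightarrow> real^3 \<Rightarrow> real^3" where
  "affine_action g Y = fst g *v Y + snd g"

definition Aut_semidirect :: "(real^3) set \<Rightarrow> ((real^3^3) \<times> (real^3)) monoid" where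
  "Aut_semidirect C =
     \<lparr>carrier = Aut_cone C \<times> UNIV,
      mult = (\<lambda>g h. (fst g ** fst h, fst g *v snd h + snd g)),
      one = (mat 1, 0)\<rparr>"


section \<open>Convex tube domains and their automorphisms\<close>

text \<open>
  A polarized affine 3-space is given by a hyperplane \<open>E\<close> of \<open>real^4\<close>, whose complement
  \<open>affine_chart E\<close> is the affine space, and a line \<open>q\<close> in \<open>E\<close>, the polarization.
  Affine coordinates on \<open>affine_chart E\<close> are described by their inverse \<open>affine_param N\<close>,
  where \<open>N\<close> is an invertible matrix sending the hyperplane of vectors with vanishing last
  coordinate to \<open>E\<close>; the point at infinity of the vertical lines is then spanned by the third
  column of \<open>N\<close>.
\<close>

definition affine_param :: "real^4^4 \<Rightarrow> real^2 \<Rightarrow> real \<Rightarrow> (real^4) set" where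
  "affine_param N x z = span {N *v vector [x$1, x$2, z, 1]}"

definition polarized_coordinates :: "(real^4) set \<Rightarrow> (real^4) set \<Rightarrow> real^4^4 \<Rightarrow> bool" where
  "polarized_coordinates E q N \<longleftrightarrow>
     invertible N \<and> ((*v) N) ` {u. u$4 = 0} = E \<and> span {N *v axis 3 1} = q"

definition tube_coordinates ::
    "(real^4) set \<Rightarrow> (real^4) set \<Rightarrow> (real^4) set set \<Rightarrow> real^4^4 \<Rightarrow> (real^2) set \<Rightarrow> bool" where
  "tube_coordinates E q T N \<Omega> \<longleftrightarrow>
     polarized_coordinates E q N \<and>
     open \<Omega> \<and> convex \<Omega> \<and> bounded \<Omega> \<and> \<Omega> \<noteq> {} \<and>
     T = {affine_param N x z |x z. x \<in> \<Omega>}"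

definition convex_tube_domain ::
    "(real^4) set \<Rightarrow> (real^4) set \<Rightarrow> (real^4) set set \<Rightarrow> bool" where
  "convex_tube_domain E q T \<longleftrightarrow> (\<exists>N \<Omega>. tube_coordinates E q T N \<Omega>)"

text \<open>
  The transformation preserves the upward orientation of vertical lines and the orientation of the
  planar domain: in coordinates it
  has the form \<open>(x, z) \<mapsto> (f x, g\<^sub>x z)\<close> with every \<open>g\<^sub>x\<close> increasing, and the induced
  transformation \<open>f\<close> of \<open>\<Omega>\<close> preserves orientation, i.e. has positive Jacobian determinant.
\<close>

definition preserves_tube_orientations ::
    "real^4^4 \<Rightarrow> (real^2) set \<Rightarrow> ((real^4) set \<Rightarrow> (real^4) set) \<Rightarrow> bool" where
  "preserves_tube_orientations N \<Omega> \<Phi> \<longleftrightarrow>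
     (\<exists>f :: real^2 \<Rightarrow> real^2.
        (\<forall>x\<in>\<Omega>. \<exists>g :: real \<Rightarrow> real. strict_mono g \<and>
            (\<forall>z. \<Phi> (affine_param N x z) = affine_param N (f x) (g z))) \<and>
        (\<forall>x\<in>\<Omega>. \<exists>D. (f has_derivative D) (at x) \<and> det (matrix D) > 0))"

text \<open>The representatives of determinant 1 or -1 differ only by sign, so the choice does not matter.\<close>

definition unit_eigenvalue_at ::
    "(real^4) set \<Rightarrow> ((real^4) set \<Rightarrow> (real^4) set) \<Rightarrow> bool" where
  "unit_eigenvalue_at q \<Phi> \<longleftrightarrow>
     (\<exists>A. \<bar>det A\<bar> = 1 \<and> \<Phi> = proj_map A \<and>
        (\<exists>c. \<bar>c\<bar> = 1 \<and> (\<forall>u\<in>q. A *v u = c *\<^sub>R u)))"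

text \<open>
  Two systems of tube coordinates of the same tube differ by \<open>(x, z) \<mapsto> (\<alpha> x, c * z + \<beta> x)\<close> with
  \<open>\<alpha>\<close>, \<open>\<beta>\<close> affine and \<open>c \<noteq> 0\<close>, so the following does not depend on the chosen coordinates.
\<close>

definition tube_automorphism ::
    "(real^4) set \<Rightarrow> (real^4) set \<Rightarrow> (real^4) set set \<Rightarrow> ((real^4) set \<Rightarrow> (real^4) set) \<Rightarrow> bool" where
  "tube_automorphism E q T \<Phi> \<longleftrightarrow>
     \<Phi> \<in> homographies \<and> \<Phi> ` T = T \<and>
     (\<exists>N \<Omega>. tube_coordinates E q T N \<Omega> \<and> preserves_tube_orientations N \<Omega> \<Phi>) \<and>
     unit_eigenvalue_at q \<Phi>"

definition Aut_tube ::
    "(real^4) set \<Rightarrow> (real^4) set \<Rightarrow> (real^4) set set \<Rightarrow> ((real^4) set \<Rightarrow> (real^4) set) monoid" where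
  "Aut_tube E q T = (BijGroup projective_space) \<lparr>carrier := {\<Phi>. tube_automorphism E q T \<Phi>}\<rparr>"

text \<open>
  The affine plane \<open>real^2\<close> is viewed as a chart of the projective plane by \<open>planar_point\<close>.
\<close>

definition planar_point :: "real^2 \<Rightarrow> (real^3) set" where
  "planar_point x = span {vector [x$1, x$2, 1]}"


section \<open>Consistency of the encoding\<close>

lemma vector_4:
  "(vector [a, b, c, d] :: ('a::zero)^4) $ 1 = a"
  "(vector [a, b, c, d] :: ('a::zero)^4) $ 2 = b"
  "(vector [a, b, c, d] :: ('a::zero)^4) $ 3 = c"
  "(vector [a, b, c, d] :: ('a::zero)^4) $ 4 = d"
  unfolding vector_def by simp_all

lemma homog_inner: "homog a s \<bullet> homog b t = a \<bullet> b + s * t"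
  by (simp add: homog_def inner_vec_def sum_3 sum_4 vector_4)

lemma homog_cases: obtains a t where "u = homog a t"
proof -
  have "u = homog (vector [u$1, u$2, u$3]) (u$4)"
    by (simp add: homog_def vec_eq_iff forall_4 vector_4)
  then show ?thesis using that by blast
qed

lemma homog_eq_iff: "homog a s = homog b t \<longleftrightarrow> a = b \<and> s = t"
  by (auto simp add: homog_def vec_eq_iff forall_4 vector_4 forall_3)

lemma homog_scaleR: "c *\<^sub>R homog a s = homog (c *\<^sub>R a) (c * s)"
  by (simp add: homog_def vec_eq_iff forall_4 vector_4)

lemma homog_0: "homog 0 0 = 0"
  by (simp add: homog_def vec_eq_iff forall_4 vector_4)

lemma affine_plane_iff: "affine_plane H \<longleftrightarrow> (\<exists>a b. a \<noteq> 0 \<and> H = {Y. a \<bullet> Y = b})"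
proof
  assume "affine_plane H"
  then have "affine H" "aff_dim H = int DIM(real^3) - 1"
    by (auto simp: affine_plane_def)
  then show "\<exists>a b. a \<noteq> 0 \<and> H = {Y. a \<bullet> Y = b}"
    using aff_dim_eq_hyperplane[of H] by (auto simp: affine_hull_eq[THEN iffD2])
next
  assume "\<exists>a b. a \<noteq> 0 \<and> H = {Y. a \<bullet> Y = b}"
  then show "affine_plane H"
    by (auto simp: affine_plane_def affine_hyperplane)
qed

lemma direction_plane:
  assumes "a \<noteq> 0" shows "direction {Y. a \<bullet> Y = b} = {v. a \<bullet> v = 0}"
proof (intro equalityI subsetI)
  fix v assume "v \<in> {v. a \<bullet> v = 0}"
  then have v: "a \<bullet> v = 0" by simp
  define Y where "Y = (b / (a \<bullet> a)) *\<^sub>R a"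
  have "a \<bullet> Y = b" using assms by (simp add: Y_def)
  then show "v \<in> direction {Y. a \<bullet> Y = b}"
    unfolding direction_def using v
    by (intro CollectI exI[of _ "Y + v"] exI[of _ Y]) (auto simp: inner_add_right)
qed (auto simp: direction_def inner_diff_right)

lemma dual_point_plane:
  assumes "a \<noteq> 0" shows "dual_point {Y. a \<bullet> Y = b} = span {homog a (- b)}"
proof (intro equalityI subsetI)
  fix u assume "u \<in> span {homog a (- b)}"
  then show "u \<in> dual_point {Y. a \<bullet> Y = b}"
    by (auto simp: span_singleton dual_point_def homog_inner)
next
  fix u assume u: "u \<in> dual_point {Y. a \<bullet> Y = b}"
  obtain c t where ct: "u = homog c t" by (rule homog_cases)
  have *: "c \<bullet> Y + t = 0" if "a \<bullet> Y = b" for Y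
    using u that by (auto simp: dual_point_def ct homog_inner)
  define Y0 where "Y0 = (b / (a \<bullet> a)) *\<^sub>R a"
  have Y0: "a \<bullet> Y0 = b" using assms by (simp add: Y0_def)
  define k where "k = (c \<bullet> a) / (a \<bullet> a)"
  define w where "w = c - k *\<^sub>R a"
  have aw: "a \<bullet> w = 0" using assms by (simp add: w_def k_def inner_diff_right inner_commute)
  have "c \<bullet> w = 0"
    using *[of "Y0 + w"] *[of Y0] Y0 aw by (auto simp: inner_add_right)
  then have "w \<bullet> w = 0"
    using aw by (simp add: w_def[of] inner_diff_left inner_commute)
  then have c: "c = k *\<^sub>R a" by (simp add: w_def)
  have "t = - (k * b)" using *[OF Y0] Y0 by (simp add: c)
  then have "u = k *\<^sub>R homog a (- b)" by (simp add: ct c homog_scaleR)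
  then show "u \<in> span {homog a (- b)}" by (auto simp: span_singleton)
qed

lemma span_singleton_in_projective_space: "v \<noteq> 0 \<Longrightarrow> span {v} \<in> projective_space"
  by (simp add: projective_space_def dim_insert)

lemma projective_space_cases:
  assumes "l \<in> projective_space" obtains v where "v \<noteq> 0" "l = span {v}"
proof -
  obtain B where B: "B \<subseteq> l" "independent B" "l \<subseteq> span B" "card B = dim l"
    using basis_exists by blast
  from B assms have "card B = 1" by (simp add: projective_space_def)
  then obtain v where v: "B = {v}" by (rule card_1_singletonE)
  have "v \<noteq> 0" using B v by (auto simp: dependent_zero)
  moreover have "l = span {v}"
    using B v assms span_minimal[of B l] by (auto simp: projective_space_def)
  ultimately show ?thesis using that by blast
qed

lemma dual_point_infinity_eq: "dual_point_infinity = span {homog 0 1}"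
proof (intro equalityI subsetI)
  fix u assume u: "u \<in> dual_point_infinity"
  obtain c t where ct: "u = homog c t" by (rule homog_cases)
  have "c \<bullet> c = 0" using u by (auto simp: dual_point_infinity_def ct homog_inner)
  then have "u = t *\<^sub>R homog 0 1" by (simp add: ct homog_scaleR)
  then show "u \<in> span {homog 0 1}" by (auto simp: span_singleton)
qed (auto simp: dual_point_infinity_def span_singleton homog_inner)

text \<open>The dual projective space consists of the affine planes and the plane at infinity.\<close>

lemma dual_point_infinity_in: "dual_point_infinity \<in> projective_space"
  unfolding dual_point_infinity_eq
  by (rule span_singleton_in_projective_space) (simp add: homog_eq_iff flip: homog_0)

lemma bij_betw_dual_point:
  "bij_betw dual_point {H. affine_plane H} (projective_space - {dual_point_infinity})"
proof (rule bij_betw_imageI)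
  have recover: "H = {Y. \<forall>u \<in> dual_point H. u \<bullet> homog Y 1 = 0}" if H: "affine_plane H" for H
  proof -
    obtain a b where "a \<noteq> 0" "H = {Y. a \<bullet> Y = b}" 
      using H unfolding affine_plane_iff by (elim exE conjE)
    have "homog a (- b) \<in> dual_point H"
      by (simp add: \<open>a \<noteq> 0\<close> \<open>H = _\<close> dual_point_plane span_base)
    moreover have "u \<bullet> homog Y 1 = 0" if "u \<in> dual_point H" "Y \<in> H" for u Y
      using that by (simp add: dual_point_def)
    ultimately show ?thesis using \<open>H = _\<close> by (fastforce simp: homog_inner)
  qed
  show "inj_on dual_point {H. affine_plane H}"
  proof (rule inj_onI)
    fix H H' assume H: "H \<in> {H. affine_plane H}" "H' \<in> {H. affine_plane H}"
      and eq: "dual_point H = dual_point H'"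
    from H have "affine_plane H" "affine_plane H'" by simp_all
    have "H = {Y. \<forall>u \<in> dual_point H'. u \<bullet> homog Y 1 = 0}"
      using recover[OF \<open>affine_plane H\<close>] unfolding eq .
    also have "\<dots> = H'" using recover[OF \<open>affine_plane H'\<close>] by (rule sym)
    finally show "H = H'" .
  qed
  show "dual_point ` {H. affine_plane H} = projective_space - {dual_point_infinity}"
  proof (intro equalityI subsetI)
    fix l assume "l \<in> dual_point ` {H. affine_plane H}"
    then obtain H where H: "affine_plane H" "l = dual_point H" by auto
    from H(1) obtain a b where "a \<noteq> 0" "H = {Y. a \<bullet> Y = b}"
      unfolding affine_plane_iff by (elim exE conjE)
    then have ab: "a \<noteq> 0" "l = span {homog a (- b)}" by (simp_all add: H(2) dual_point_plane)
    have "homog a (- b) \<noteq> 0" using ab by (simp add: homog_eq_iff flip: homog_0)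
    moreover have "homog a (- b) \<notin> dual_point_infinity"
      using ab by (auto simp: dual_point_infinity_def homog_inner dest!: spec[of _ a])
    ultimately show "l \<in> projective_space - {dual_point_infinity}"
      using ab span_singleton_in_projective_space span_base by blast
  next
    fix l assume l: "l \<in> projective_space - {dual_point_infinity}"
    then obtain v where v: "v \<noteq> 0" "l = span {v}" using projective_space_cases by blast
    obtain a t where at: "v = homog a t" by (rule homog_cases)
    have "a \<noteq> 0"
    proof
      assume "a = 0"
      then have "t \<noteq> 0" "v = t *\<^sub>R homog 0 1" using v at by (auto simp: homog_0 homog_scaleR)
      then have "l = dual_point_infinity"
        using span_image_scale[of "{homog 0 1}" "\<lambda>_. t"] by (simp add: v dual_point_infinity_eq)
      then show False using l by blast
    qed
    then have "l = dual_point {Y. a \<bullet> Y = - t}" by (simp add: dual_point_plane v at)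
    moreover have "affine_plane {Y. a \<bullet> Y = - t}"
      using \<open>a \<noteq> 0\<close> by (auto simp: affine_plane_def affine_hyperplane)
    ultimately show "l \<in> dual_point ` {H. affine_plane H}" by simp
  qed
qed

lemma bij_betw_dual_affine_space:
  assumes "p \<in> projective_space"
  shows "bij_betw dual_point (dual_affine_space p) (affine_chart (dual_hyperplane p))"
proof -
  have inf: "dual_point_infinity \<subseteq> dual_hyperplane p"
    by (auto simp: dual_point_infinity_def dual_hyperplane_def)
  have *: "dual_point H \<subseteq> dual_hyperplane p \<longleftrightarrow> p \<subseteq> direction H" if H: "affine_plane H" for H
  proof -
    obtain a b where "a \<noteq> 0" "H = {Y. a \<bullet> Y = b}" 
      using H unfolding affine_plane_iff by (elim exE conjE)
    have "subspace (dual_hyperplane p)"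
      by (auto simp: dual_hyperplane_def subspace_def inner_add_left)
    then have "span {homog a (- b)} \<subseteq> dual_hyperplane p \<longleftrightarrow> homog a (- b) \<in> dual_hyperplane p"
      by (meson empty_subsetI insert_subset span_base singletonI span_minimal subsetD)
    then show ?thesis
      using \<open>a \<noteq> 0\<close> \<open>H = _\<close>
      by (auto simp: dual_point_plane direction_plane dual_hyperplane_def homog_inner)
  qed
  have "dual_point ` dual_affine_space p = affine_chart (dual_hyperplane p)"
  proof (intro equalityI subsetI)
    fix l assume "l \<in> dual_point ` dual_affine_space p"
    then show "l \<in> affine_chart (dual_hyperplane p)"
      using * bij_betw_dual_point[THEN bij_betw_imp_surj_on]
      by (auto simp: dual_affine_space_def affine_chart_def)
  next
    fix l assume l: "l \<in> affine_chart (dual_hyperplane p)"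
    then have "l \<in> projective_space - {dual_point_infinity}"
      using inf by (auto simp: affine_chart_def)
    then obtain H where "affine_plane H" "l = dual_point H"
      using bij_betw_dual_point[THEN bij_betw_imp_surj_on] by blast
    then show "l \<in> dual_point ` dual_affine_space p"
      using l * by (auto simp: dual_affine_space_def affine_chart_def)
  qed
  moreover have "dual_affine_space p \<subseteq> {H. affine_plane H}"
    by (auto simp: dual_affine_space_def)
  ultimately show ?thesis by (intro bij_betw_subset[OF bij_betw_dual_point])
qed

lemma group_Aut_semidirect: "group (Aut_semidirect C)"
proof (rule groupI)
  fix g h assume gh: "g \<in> carrier (Aut_semidirect C)" "h \<in> carrier (Aut_semidirect C)"
  have "((*v) (fst g ** fst h)) ` C = C"
    using gh by (auto simp: Aut_semidirect_def Aut_cone_def image_image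
        simp flip: matrix_vector_mul_assoc) (metis image_eqI image_image)+
  then show "g \<otimes>\<^bsub>Aut_semidirect C\<^esub> h \<in> carrier (Aut_semidirect C)"
    using gh by (auto simp: Aut_semidirect_def Aut_cone_def det_mul)
next
  show "\<one>\<^bsub>Aut_semidirect C\<^esub> \<in> carrier (Aut_semidirect C)"
    by (auto simp: Aut_semidirect_def Aut_cone_def)
next
  fix g assume g: "g \<in> carrier (Aut_semidirect C)"
  obtain A X where gA: "g = (A, X)" by (cases g)
  from g gA have A: "det A = 1" "((*v) A) ` C = C"
    by (auto simp: Aut_semidirect_def Aut_cone_def)
  then have "invertible A" by (simp add: invertible_det_nz)
  then obtain B where B: "A ** B = mat 1" "B ** A = mat 1" by (auto simp: invertible_def)
  have "det A * det B = 1" using B(1) det_mul[of A B] by simp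
  then have "det B = 1" using A by simp
  moreover have "((*v) B) ` C = ((*v) B) ` ((*v) A) ` C" using A by simp
  then have "((*v) B) ` C = C" by (simp add: image_image matrix_vector_mul_assoc B)
  ultimately show "\<exists>h\<in>carrier (Aut_semidirect C). h \<otimes>\<^bsub>Aut_semidirect C\<^esub> g = \<one>\<^bsub>Aut_semidirect C\<^esub>"
    using B by (intro bexI[of _ "(B, - (B *v X))"]) (auto simp: Aut_semidirect_def Aut_cone_def gA)
qed (auto simp: Aut_semidirect_def matrix_mul_assoc matrix_vector_mul_assoc
       matrix_vector_right_distrib add.assoc)

lemma homographies_subset_Bij: "homographies \<subseteq> Bij projective_space"
proof
  fix \<Phi> :: "(real^'n) set \<Rightarrow> (real^'n) set" assume "\<Phi> \<in> homographies"
  then obtain A :: "real^'n^'n" where A: "invertible A" "\<Phi> = proj_map A"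
    by (auto simp: homographies_def)
  obtain B where B: "A ** B = mat 1" "B ** A = mat 1" using A by (auto simp: invertible_def)
  have mem: "((*v) M) ` l \<in> projective_space"
    if l: "l \<in> projective_space" and M: "M' ** M = mat 1" for M M' :: "real^'n^'n" and l
  proof -
    obtain v where v: "v \<noteq> 0" "l = span {v}" using projective_space_cases[OF l] .
    have "M' *v (M *v v) = v" by (simp add: matrix_vector_mul_assoc M)
    then have "M *v v \<noteq> 0" using v by force
    moreover have "((*v) M) ` l = span {M *v v}" by (simp add: v linear_span_image[symmetric])
    ultimately show ?thesis by (simp add: span_singleton_in_projective_space)
  qed
  have "bij_betw \<Phi> projective_space projective_space"
    by (rule bij_betw_byWitness[where f' = "proj_map B"])
      (auto simp: A proj_map_def mem[OF _ B(1)] mem[OF _ B(2)] image_image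
        matrix_vector_mul_assoc B)
  then show "\<Phi> \<in> Bij projective_space"
    by (simp add: Bij_def A proj_map_def extensional_def)
qed

end

theory Submission
  imports Defs
begin

text \<open>
  Write a plane \<open>a \<bullet> Y = b\<close> as the point \<open>homog a (- b)\<close> of the dual projective space. It is
  \<open>C\<close>-spacelike exactly when the linear form \<open>a\<close> has no zero on \<open>closure C - {0}\<close>. That set is convex
  because \<open>C\<close> contains no line, so \<open>a\<close> has constant sign there and may be normalised to lie in
  \<open>dual_cone C\<close>, while \<open>b\<close> is arbitrary (\<open>dual_points_spacelike\<close>). Hence the spacelike planes form the
  set \<open>dual_tube C\<close> of all lines \<open>span {homog a s}\<close> with \<open>a\<close> in the dual cone.

  Let \<open>w \<in> C\<close> span the polarization. Since \<open>w\<close> is an interior point of \<open>C\<close>, it is positive on the nonzero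
  points of the closure of the dual cone (\<open>dual_cone_dual_cone\<close>), so that \<open>w \<bullet> a = 1\<close> cuts out a bounded
  section. Normalising each line by \<open>w \<bullet> a = 1\<close> leaves \<open>s\<close> as a free vertical coordinate over this
  section, which is the tube structure (\<open>convex_tube_domain_dual_tube\<close>). Any other tube coordinates
  have the same two ingredients up to a linear change of frame (\<open>tube_coordinates_dual_tube\<close>), and the
  inverse frame is the homography that identifies the planar domain with the section.

  An affine map \<open>(A, X)\<close> acts on linear forms by the contragredient of its matrix on \<open>real^4\<close>. This
  contragredient fixes \<open>homog 0 1\<close>, the vertical direction, and induces the contragredient of \<open>A\<close> on the
  \<open>a\<close>-part, so it preserves the tube iff \<open>A\<close> preserves \<open>C\<close> up to sign. For the converse, take an
  automorphism and its representative \<open>M\<close> that fixes \<open>homog 0 1\<close>, which exists by the eigenvalue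
  condition. The contragredient of \<open>M\<close> preserves the last coordinate, hence is the matrix of
  an affine map \<open>(A, X)\<close>. In any tube coordinates the two orientation conditions say precisely that
  \<open>det M > 0\<close> and that the contragredient of \<open>A\<close> maps the dual cone to itself and not to its negative
  (\<open>preserves_tube_orientations_iff\<close>, \<open>preserves_dual_tube_orientations_iff\<close>). With \<open>\<bar>det M\<bar> = 1\<close> the
  former gives \<open>det A = 1\<close>, and biduality turns the latter into \<open>A C = C\<close>. Injectivity holds because
  two invertible matrices that induce the same homography and fix a common nonzero vector are equal.
\<close>

section \<open>Convex cones and their duals\<close>

definition positively_homogeneous :: "'a::real_vector set \<Rightarrow> bool" where
  "positively_homogeneous K \<longleftrightarrow> (\<forall>x\<in>K. \<forall>t>0. t *\<^sub>R x \<in> K)"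

lemma positively_homogeneous_closure:
  fixes K :: "'a::real_normed_vector set"
  assumes "positively_homogeneous K"
  shows "positively_homogeneous (closure K)"
  unfolding positively_homogeneous_def
proof (intro ballI allI impI)
  fix x :: 'a and t :: real assume x: "x \<in> closure K" and t: "t > 0"
  have "(*\<^sub>R) t ` closure K = closure ((*\<^sub>R) t ` K)" by (rule closure_scaleR)
  moreover have "(*\<^sub>R) t ` K \<subseteq> K" using assms t by (auto simp: positively_homogeneous_def)
  ultimately show "t *\<^sub>R x \<in> closure K" using x closure_mono by blast
qed

lemma positively_homogeneous_dual_cone: "positively_homogeneous (dual_cone K)"
  by (auto simp: positively_homogeneous_def dual_cone_def)

lemma convex_dual_cone: "convex (dual_cone K)"
proof -
  have "dual_cone K = (\<Inter>x \<in> closure K - {0}. {a. x \<bullet> a > 0})"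
    by (auto simp: dual_cone_def inner_commute)
  then show ?thesis by (simp add: convex_INT convex_halfspace_gt)
qed

text \<open>
  Uniform positivity by compactness: the closure of \<open>K\<close> meets the unit sphere in a compact set, on
  which \<open>w\<close> attains a positive minimum. This quantitative form yields both the openness of the dual
  cone and the boundedness of the sections of \<open>K\<close> by \<open>w\<close>.
\<close>

lemma dual_cone_bound:
  assumes K: "positively_homogeneous K" and w: "w \<in> dual_cone K"
  obtains m where "m > 0" "\<And>x. x \<in> closure K \<Longrightarrow> m * norm x \<le> w \<bullet> x"
proof -
  define S where "S = closure K \<inter> sphere 0 1"
  have comp: "compact S" unfolding S_def by (intro closed_Int_compact) auto
  have "\<exists>m>0. \<forall>x\<in>S. m \<le> w \<bullet> x"
  proof (cases "S = {}")
    case True then show ?thesis by (auto intro: exI[of _ 1])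
  next
    case False
    have "continuous_on S (\<lambda>x. w \<bullet> x)" by (intro continuous_intros)
    then obtain x0 where x0: "x0 \<in> S" "\<forall>x\<in>S. w \<bullet> x0 \<le> w \<bullet> x"
      using continuous_attains_inf[OF comp False] by blast
    have "w \<bullet> x0 > 0" using x0(1) w by (auto simp: S_def dual_cone_def)
    with x0 show ?thesis by blast
  qed
  then obtain m where m: "m > 0" "\<forall>x\<in>S. m \<le> w \<bullet> x" by blast
  show ?thesis
  proof
    show "m > 0" by fact
    fix x assume x: "x \<in> closure K"
    show "m * norm x \<le> w \<bullet> x"
    proof (cases "x = 0")
      case False
      then have "(1 / norm x) *\<^sub>R x \<in> S"
        using positively_homogeneous_closure[OF K] x by (auto simp: S_def positively_homogeneous_def)
      then have "m \<le> w \<bullet> ((1 / norm x) *\<^sub>R x)" using m by blast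
      then show ?thesis using False by (simp add: field_simps)
    qed simp
  qed
qed

lemma open_dual_cone:
  assumes "positively_homogeneous K" shows "open (dual_cone K)"
  unfolding open_contains_ball
proof
  fix w assume "w \<in> dual_cone K"
  then obtain m where m: "m > 0" "\<And>x. x \<in> closure K \<Longrightarrow> m * norm x \<le> w \<bullet> x"
    using dual_cone_bound[OF assms] by metis
  have "ball w m \<subseteq> dual_cone K"
  proof
    fix a assume a: "a \<in> ball w m"
    have "a \<bullet> x > 0" if x: "x \<in> closure K - {0}" for x
    proof -
      have "(w - a) \<bullet> x \<le> norm (w - a) * norm x" by (rule norm_cauchy_schwarz)
      also have "\<dots> < m * norm x" using a x by (simp add: dist_norm)
      also have "\<dots> \<le> w \<bullet> x" using m x by blast
      finally show ?thesis by (simp add: inner_diff_left)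
    qed
    then show "a \<in> dual_cone K" by (simp add: dual_cone_def)
  qed
  then show "\<exists>e>0. ball w e \<subseteq> dual_cone K" using m by blast
qed

lemma proper_convex_cone_homogeneous:
  "proper_convex_cone C \<Longrightarrow> positively_homogeneous C"
  by (simp add: proper_convex_cone_def positively_homogeneous_def)

text \<open>
  If \<open>v\<close> and \<open>- v\<close> were both limits of the open convex cone \<open>C\<close>, every point of \<open>C\<close> could be moved along
  \<open>v\<close> in both directions without leaving \<open>C\<close>, which would give a line in \<open>C\<close>.
\<close>

lemma closure_pointed:
  assumes C: "proper_convex_cone C" and v: "v \<in> closure C" "- v \<in> closure C"
  shows "v = 0"
proof (rule ccontr)
  assume "v \<noteq> 0"
  have oc: "open C" "convex C" "C \<noteq> {}" using C by (auto simp: proper_convex_cone_def)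
  then obtain x where x: "x \<in> C" by blast
  have hom: "positively_homogeneous C" "positively_homogeneous (closure C)"
    using C by (simp_all add: proper_convex_cone_homogeneous positively_homogeneous_closure)
  have add: "x + u \<in> C" if u: "u \<in> closure C" for u
  proof -
    \<comment> \<open>The midpoint of an interior point and a limit point is interior; doubling it gives the sum.\<close>
    have "u - (1/2) *\<^sub>R (u - x) \<in> interior C"
      using x u oc by (intro mem_interior_closure_convex_shrink) (auto simp: interior_open)
    then have "2 *\<^sub>R (u - (1/2) *\<^sub>R (u - x)) \<in> C"
      using hom interior_subset[of C] unfolding positively_homogeneous_def
      by (meson subsetD zero_less_numeral)
    moreover have "2 *\<^sub>R (u - (1/2) *\<^sub>R (u - x)) = x + u"
      by (simp add: scaleR_right_diff_distrib scaleR_2)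
    ultimately show ?thesis by simp
  qed
  have "x + t *\<^sub>R v \<in> C" for t
  proof -
    consider "t = 0" | "t > 0" | "t < 0" by linarith
    then show ?thesis
    proof cases
      case 1 then show ?thesis using x by simp
    next
      case 2 then show ?thesis using add v hom by (auto simp: positively_homogeneous_def)
    next
      case 3
      then have "(- t) *\<^sub>R (- v) \<in> closure C"
        using v hom unfolding positively_homogeneous_def by (meson neg_0_less_iff_less)
      then show ?thesis using add by fastforce
    qed
  qed
  then show False using C \<open>v \<noteq> 0\<close> unfolding proper_convex_cone_def by blast
qed

text \<open>
  A segment in the closed cone that passes through \<open>0\<close> would have opposite endpoints up to scaling. The
  convexity is used twice: to separate the cone from \<open>0\<close>, and to see that a form without zeros on it
  has constant sign.
\<close>

lemma convex_closure_minus_zero: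
  assumes C: "proper_convex_cone C" shows "convex (closure C - {0})"
proof (rule convexI)
  fix x y :: "real^3" and u v :: real
  assume xy: "x \<in> closure C - {0}" "y \<in> closure C - {0}" and uv: "0 \<le> u" "0 \<le> v" "u + v = 1"
  have "convex (closure C)" using C by (auto simp: proper_convex_cone_def intro: convex_closure)
  then have "u *\<^sub>R x + v *\<^sub>R y \<in> closure C" using xy uv by (auto simp: convex_def)
  moreover have "u *\<^sub>R x + v *\<^sub>R y \<noteq> 0"
  proof
    assume eq: "u *\<^sub>R x + v *\<^sub>R y = 0"
    have "u \<noteq> 0" "v \<noteq> 0" using eq uv xy by auto
    then have pos: "u > 0" "v / u > 0" using uv by auto
    have "- x = (v / u) *\<^sub>R y"
    proof -
      have "u *\<^sub>R (- x) = u *\<^sub>R ((v / u) *\<^sub>R y)"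
        using eq pos by (simp add: eq_neg_iff_add_eq_0 add.commute flip: neg_eq_iff_add_eq_0)
      then show ?thesis using pos by (metis scaleR_cancel_left less_irrefl)
    qed
    moreover have "(v / u) *\<^sub>R y \<in> closure C"
      using positively_homogeneous_closure[OF proper_convex_cone_homogeneous[OF C]] pos xy
      by (auto simp: positively_homogeneous_def)
    ultimately have "x = 0" using closure_pointed[OF C, of x] xy by simp
    then show False using xy by simp
  qed
  ultimately show "u *\<^sub>R x + v *\<^sub>R y \<in> closure C - {0}" by simp
qed

text \<open>
  The unit vectors of the closed cone have a compact convex hull that misses \<open>0\<close>. A hyperplane strictly
  separating this hull from \<open>0\<close> is a form that is positive on the closed cone away from \<open>0\<close>.
\<close>

lemma dual_cone_nonempty:
  assumes C: "proper_convex_cone C" shows "dual_cone C \<noteq> {}"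
proof -
  define S where "S = closure C \<inter> sphere 0 1"
  have "compact S" unfolding S_def by (intro closed_Int_compact) auto
  then have comp: "closed (convex hull S)" by (intro compact_imp_closed compact_convex_hull)
  have "convex hull S \<subseteq> closure C - {0}"
    by (rule hull_minimal) (auto simp: S_def convex_closure_minus_zero[OF C])
  then have "0 \<notin> convex hull S" by blast
  then obtain a b where ab: "0 < b" "\<forall>x\<in>convex hull S. a \<bullet> x > b"
    using separating_hyperplane_closed_0[OF convex_convex_hull comp] by blast
  have "a \<bullet> x > 0" if x: "x \<in> closure C - {0}" for x
  proof -
    have "(1 / norm x) *\<^sub>R x \<in> S"
      using positively_homogeneous_closure[OF proper_convex_cone_homogeneous[OF C]] x
      by (auto simp: S_def positively_homogeneous_def)
    then have "(1 / norm x) *\<^sub>R x \<in> convex hull S" by (simp add: hull_inc)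
    then have "a \<bullet> ((1 / norm x) *\<^sub>R x) > 0" using ab by fastforce
    then show ?thesis using x by (simp add: zero_less_divide_iff)
  qed
  then show ?thesis by (auto simp: dual_cone_def)
qed

text \<open>
  Biduality for open cones. The dual cone consists of forms positive up to the boundary, and taking it
  twice gives back the open cone itself rather than its closure: a point outside \<open>C\<close> is separated
  from \<open>C\<close> by a form that need only be nonnegative on \<open>C\<close>, but such a form lies in the closure of the
  dual cone.
\<close>

lemma dual_cone_dual_cone:
  assumes C: "proper_convex_cone C" shows "dual_cone (dual_cone C) = C"
proof (intro equalityI subsetI)
  fix w assume w: "w \<in> C"
  have "open C" using C by (simp add: proper_convex_cone_def)
  then obtain e where e: "e > 0" "cball w e \<subseteq> C" using w open_contains_cball by blast
  have "w \<bullet> a > 0" if a: "a \<in> closure (dual_cone C) - {0}" for a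
  proof -
    have nonneg: "x \<bullet> a \<ge> 0" if x: "x \<in> C" for x
    proof -
      have "dual_cone C \<subseteq> {a. x \<bullet> a \<ge> 0}"
      proof
        fix b assume "b \<in> dual_cone C"
        then show "b \<in> {a. x \<bullet> a \<ge> 0}" using x closure_subset[of C]
          by (cases "x = 0") (auto simp: dual_cone_def inner_commute[of x] intro!: less_imp_le)
      qed
      then have "closure (dual_cone C) \<subseteq> {a. x \<bullet> a \<ge> 0}"
        by (rule closure_minimal) (simp add: closed_halfspace_ge)
      then show ?thesis using a by blast
    qed
    \<comment> \<open>Moving from \<open>w\<close> a little against \<open>a\<close> stays in \<open>C\<close>, so \<open>a\<close> cannot vanish at \<open>w\<close>.\<close>
    have "w - (e / norm a) *\<^sub>R a \<in> C" using e a by (intro subsetD[OF e(2)]) (simp add: dist_norm)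
    from nonneg[OF this] have "(e / norm a) * (a \<bullet> a) \<le> w \<bullet> a" by (simp add: inner_diff_left)
    moreover have "(e / norm a) * (a \<bullet> a) > 0" using e a by simp
    ultimately show ?thesis by linarith
  qed
  then show "w \<in> dual_cone (dual_cone C)" by (simp add: dual_cone_def)
next
  fix x assume x: "x \<in> dual_cone (dual_cone C)"
  show "x \<in> C"
  proof (rule ccontr)
    assume "x \<notin> C"
    have oc: "open C" "convex C" "C \<noteq> {}" using C by (auto simp: proper_convex_cone_def)
    have hom: "positively_homogeneous C" using C by (rule proper_convex_cone_homogeneous)
    obtain a b where ab: "a \<noteq> 0" "\<forall>y\<in>{x}. a \<bullet> y \<le> b" "\<forall>y\<in>C. b \<le> a \<bullet> y"
      using separating_hyperplane_sets[of "{x}" C] \<open>x \<notin> C\<close> oc by auto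
    have nonneg: "a \<bullet> y \<ge> 0" if y: "y \<in> C" for y
    proof (rule ccontr)
      assume neg: "\<not> a \<bullet> y \<ge> 0"
      \<comment> \<open>Far out on the ray of \<open>y\<close> the value of \<open>a\<close> drops to \<open>- (\<bar>b\<bar> + 1)\<close>, below \<open>b\<close>.\<close>
      define t where "t = (\<bar>b\<bar> + 1) / - (a \<bullet> y)"
      have "t > 0" using neg unfolding t_def by (intro divide_pos_pos) auto
      then have "t *\<^sub>R y \<in> C" using y hom by (simp add: positively_homogeneous_def)
      then have "b \<le> a \<bullet> (t *\<^sub>R y)" using ab by blast
      also have "\<dots> = - (\<bar>b\<bar> + 1)" using neg by (simp add: t_def field_simps)
      finally show False by linarith
    qed
    have "b \<le> 0"
    proof (rule ccontr)
      assume b: "\<not> b \<le> 0"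
      obtain y where y: "y \<in> C" using oc by blast
      \<comment> \<open>Close to the apex on the ray of \<open>y\<close> the value of \<open>a\<close> is at most \<open>b / 2\<close>.\<close>
      define q where "q = \<bar>a \<bullet> y\<bar> + 1"
      have q: "q > 0" "a \<bullet> y \<le> q" by (simp_all add: q_def)
      have "(b / (2 * q)) *\<^sub>R y \<in> C" using y hom b q by (simp add: positively_homogeneous_def)
      then have "b \<le> a \<bullet> ((b / (2 * q)) *\<^sub>R y)" using ab by blast
      also have "\<dots> = (b / (2 * q)) * (a \<bullet> y)" by simp
      also have "\<dots> \<le> (b / (2 * q)) * q" using b q by (intro mult_left_mono) auto
      also have "\<dots> = b / 2" using q by simp
      finally show False using b by simp
    qed
    have closure_nonneg: "a \<bullet> y \<ge> 0" if "y \<in> closure C" for y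
    proof -
      have "closure C \<subseteq> {y. a \<bullet> y \<ge> 0}"
        by (rule closure_minimal) (auto simp: nonneg closed_halfspace_ge)
      then show ?thesis using that by blast
    qed
    obtain a0 where a0: "a0 \<in> dual_cone C" using dual_cone_nonempty[OF C] by blast
    \<comment> \<open>A nonnegative form becomes positive after adding a small multiple of \<open>a0\<close>.\<close>
    have "a + (1 / real (Suc n)) *\<^sub>R a0 \<in> dual_cone C" for n
      using a0 closure_nonneg by (auto simp: dual_cone_def inner_add_left intro!: add_nonneg_pos)
    moreover have "(\<lambda>n. a + (1 / real (Suc n)) *\<^sub>R a0) \<longlonglongrightarrow> a + 0 *\<^sub>R a0"
      by (intro tendsto_intros LIMSEQ_Suc lim_1_over_n)
    ultimately have "a \<in> closure (dual_cone C)"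
      unfolding closure_sequential by (auto intro!: exI[of _ "\<lambda>n. a + (1 / real (Suc n)) *\<^sub>R a0"])
    then have "x \<bullet> a > 0" using x ab by (simp add: dual_cone_def)
    then show False using ab \<open>b \<le> 0\<close> by (simp add: inner_commute)
  qed
qed

lemma dual_coneD: "w \<in> dual_cone K \<Longrightarrow> x \<in> closure K \<Longrightarrow> x \<noteq> 0 \<Longrightarrow> w \<bullet> x > 0"
  by (simp add: dual_cone_def)

lemma zero_notin_dual_cone:
  assumes C: "proper_convex_cone C" shows "0 \<notin> dual_cone C"
proof -
  have "C \<noteq> {0}" using C not_open_singleton[of "0::real^3"] by (auto simp: proper_convex_cone_def)
  then obtain x where "x \<in> C" "x \<noteq> 0" using C by (auto simp: proper_convex_cone_def)
  then show ?thesis using closure_subset by (fastforce simp: dual_cone_def)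
qed

lemma dual_cone_scale: "a \<in> dual_cone C \<Longrightarrow> t > 0 \<Longrightarrow> t *\<^sub>R a \<in> dual_cone C"
  using positively_homogeneous_dual_cone by (auto simp: positively_homogeneous_def)

lemma dual_cone_pos:
  assumes "proper_convex_cone C" "a \<in> dual_cone C" "x \<in> C" shows "x \<bullet> a > 0"
proof -
  have "x \<in> dual_cone (dual_cone C)" using dual_cone_dual_cone[OF assms(1)] assms(3) by simp
  moreover have "a \<in> closure (dual_cone C)" "a \<noteq> 0"
    using zero_notin_dual_cone[OF assms(1)] assms(2) closure_subset by blast+
  ultimately show ?thesis by (rule dual_coneD)
qed

lemma nonzero_cone:
  assumes "proper_convex_cone C" "w \<in> C" shows "w \<noteq> 0"
proof -
  obtain a where "a \<in> dual_cone C" using dual_cone_nonempty[OF assms(1)] by blast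
  then show ?thesis using dual_cone_pos[OF assms(1) _ assms(2)] by (metis inner_zero_left less_irrefl)
qed

section \<open>Coordinates, determinants and contragredient matrices\<close>

lemma matrix_4_mult:
  fixes K :: "real^4^4"
  shows "(K *v u) $ i = K$i$1 * u$1 + K$i$2 * u$2 + K$i$3 * u$3 + K$i$4 * u$4"
  by (simp add: matrix_vector_mult_def sum_4)

lemma matrix_3_mult:
  fixes K :: "real^3^3"
  shows "(K *v u) $ i = K$i$1 * u$1 + K$i$2 * u$2 + K$i$3 * u$3"
  by (simp add: matrix_vector_mult_def sum_3)

text \<open>
  The Leibniz expansion, from which the block formulas below follow by substituting zeros.
\<close>

lemma det_4:
  fixes M :: "'a::comm_ring_1^4^4"
  shows "det M =
     M$1$1 * M$2$2 * M$3$3 * M$4$4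
     - M$1$1 * M$2$2 * M$3$4 * M$4$3
     - M$1$1 * M$2$3 * M$3$2 * M$4$4
     + M$1$1 * M$2$3 * M$3$4 * M$4$2
     + M$1$1 * M$2$4 * M$3$2 * M$4$3
     - M$1$1 * M$2$4 * M$3$3 * M$4$2
     - M$1$2 * M$2$1 * M$3$3 * M$4$4
     + M$1$2 * M$2$1 * M$3$4 * M$4$3
     + M$1$2 * M$2$3 * M$3$1 * M$4$4
     - M$1$2 * M$2$3 * M$3$4 * M$4$1
     - M$1$2 * M$2$4 * M$3$1 * M$4$3
     + M$1$2 * M$2$4 * M$3$3 * M$4$1
     + M$1$3 * M$2$1 * M$3$2 * M$4$4
     - M$1$3 * M$2$1 * M$3$4 * M$4$2
     - M$1$3 * M$2$2 * M$3$1 * M$4$4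
     + M$1$3 * M$2$2 * M$3$4 * M$4$1
     + M$1$3 * M$2$4 * M$3$1 * M$4$2
     - M$1$3 * M$2$4 * M$3$2 * M$4$1
     - M$1$4 * M$2$1 * M$3$2 * M$4$3
     + M$1$4 * M$2$1 * M$3$3 * M$4$2
     + M$1$4 * M$2$2 * M$3$1 * M$4$3
     - M$1$4 * M$2$2 * M$3$3 * M$4$1
     - M$1$4 * M$2$3 * M$3$1 * M$4$2
     + M$1$4 * M$2$3 * M$3$2 * M$4$1"
proof -
  have f: "finite {2::4, 3, 4}" "1 \<notin> {2::4, 3, 4}" "finite {3::4, 4}" "2 \<notin> {3::4, 4}"
    "finite {4::4}" "3 \<notin> {4::4}"
    by auto
  show ?thesis
    unfolding det_def UNIV_4
    unfolding sum_over_permutations_insert[OF f(1,2)]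
    unfolding sum_over_permutations_insert[OF f(3,4)]
    unfolding sum_over_permutations_insert[OF f(5,6)]
    unfolding permutes_sing
    by (simp add: sign_swap_id sign_id swap_id_eq permutation_swap_id sign_compose permutation_compose algebra_simps)
qed

lemma matrix_inv:
  assumes "invertible (M :: 'a::semiring_1^'n^'n)"
  shows "M ** matrix_inv M = mat 1" "matrix_inv M ** M = mat 1"
  using someI_ex[OF assms[unfolded invertible_def]] by (simp_all add: matrix_inv_def)

text \<open>
  The matrix by which \<open>M\<close> acts on linear forms, when forms are vectors via the inner product.
\<close>

definition contragredient :: "real^'n^'n \<Rightarrow> real^'n^'n" where
  "contragredient M = transpose (matrix_inv M)"

lemma contragredient_inner:
  assumes "invertible M" shows "(contragredient M *v u) \<bullet> (M *v v) = u \<bullet> v"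
  by (simp add: contragredient_def dot_lmul_matrix matrix_vector_mul_assoc matrix_inv[OF assms])

lemma contragredient_unique:
  assumes "invertible M" "\<And>u v. (M' *v u) \<bullet> (M *v v) = u \<bullet> v"
  shows "M' = contragredient M"
proof -
  have "M' *v u = contragredient M *v u" for u
  proof (rule vector_eq_rdot[THEN iffD1, rule_format])
    fix v
    have "v = M *v (matrix_inv M *v v)"
      by (simp add: matrix_vector_mul_assoc matrix_inv[OF assms(1)])
    then show "(M' *v u) \<bullet> v = (contragredient M *v u) \<bullet> v"
      by (metis assms contragredient_inner)
  qed
  then show ?thesis by (simp add: matrix_eq)
qed

lemma invertible_contragredient:
  "invertible M \<Longrightarrow> invertible (contragredient M)"
  unfolding contragredient_def invertible_def
  by (metis matrix_inv matrix_transpose_mul transpose_mat invertible_def)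

lemma contragredient_contragredient:
  assumes "invertible M" shows "contragredient (contragredient M) = M"
  using contragredient_unique[OF invertible_contragredient[OF assms], of M]
    contragredient_inner[OF assms] by (simp add: inner_commute)

lemma contragredient_mult:
  assumes "invertible M" "invertible N"
  shows "contragredient (M ** N) = contragredient M ** contragredient N"
  by (rule contragredient_unique[symmetric])
    (simp_all add: assms invertible_mult contragredient_inner flip: matrix_vector_mul_assoc)

lemma det_contragredient:
  assumes "invertible M" shows "det (contragredient M) * det M = 1"
  unfolding contragredient_def det_transpose det_mul[symmetric] matrix_inv[OF assms] by simp

lemma det_scaleR_4: "det (c *\<^sub>R (M :: real^4^4)) = c ^ 4 * det M"
  by (simp add: det_4 eval_nat_numeral algebra_simps)

lemma invertible_mult_nonzero:
  fixes M :: "real^'n^'n"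
  assumes "invertible M" "v \<noteq> 0" shows "M *v v \<noteq> 0"
  using inj_matrix_vector_mult[OF assms(1)] assms(2) by (metis injD matrix_vector_mult_0_right)

text \<open>
  The contragredient leaves the pairing of forms and vectors invariant.
\<close>

lemma dual_cone_image:
  assumes "invertible M"
  shows "dual_cone ((*v) (contragredient M) ` K) = (*v) M ` dual_cone K"
proof -
  let ?M' = "contragredient M"
  have "inj ((*v) ?M')"
    using invertible_contragredient[OF assms] by (rule inj_matrix_vector_mult)
  then have cl: "closure ((*v) ?M' ` K) = (*v) ?M' ` closure K"
    by (intro closure_injective_linear_image[symmetric]) auto
  have mem: "M *v a \<in> dual_cone ((*v) ?M' ` K) \<longleftrightarrow> a \<in> dual_cone K" for a
  proof -
    have "?M' *v x = 0 \<longleftrightarrow> x = 0" for x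
      using \<open>inj ((*v) ?M')\<close> by (metis injD matrix_vector_mult_0_right)
    then have "M *v a \<in> dual_cone ((*v) ?M' ` K) \<longleftrightarrow>
        (\<forall>x\<in>closure K - {0}. (M *v a) \<bullet> (?M' *v x) > 0)"
      unfolding dual_cone_def cl by force
    then show ?thesis
      using contragredient_inner[OF assms] by (simp add: dual_cone_def inner_commute)
  qed
  show ?thesis
  proof (intro equalityI subsetI)
    fix b assume "b \<in> dual_cone ((*v) ?M' ` K)"
    moreover have "b = M *v (matrix_inv M *v b)"
      by (simp add: matrix_vector_mul_assoc matrix_inv[OF assms])
    ultimately show "b \<in> (*v) M ` dual_cone K" using mem by (metis imageI)
  qed (use mem in auto)
qed

lemma Aut_cone_dual:
  assumes C: "proper_convex_cone C" and A: "invertible A"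
  shows "(*v) A ` C = C \<longleftrightarrow> (*v) (contragredient A) ` dual_cone C = dual_cone C"
proof
  assume "(*v) A ` C = C"
  then show "(*v) (contragredient A) ` dual_cone C = dual_cone C"
    using dual_cone_image[OF invertible_contragredient[OF A], of C]
    by (simp add: contragredient_contragredient[OF A])
next
  assume "(*v) (contragredient A) ` dual_cone C = dual_cone C"
  then show "(*v) A ` C = C"
    using dual_cone_image[OF A, of "dual_cone C"] by (simp add: dual_cone_dual_cone[OF C])
qed

section \<open>Homogeneous vectors and homographies\<close>

lemma homog_add: "homog a s + homog b t = homog (a + b) (s + t)"
  by (simp add: homog_def vec_eq_iff forall_4 vector_4)

lemma homog_nonzero: "a \<noteq> 0 \<Longrightarrow> homog a s \<noteq> 0"
  by (metis homog_0 homog_eq_iff)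

lemma span_singleton_eqD:
  fixes u v :: "'a::real_vector"
  assumes "span {u} = span {v}" "u \<noteq> 0"
  obtains k where "k \<noteq> 0" "u = k *\<^sub>R v"
proof -
  have "u \<in> span {v}" using assms(1) span_base by blast
  then obtain k where "u = k *\<^sub>R v" by (auto simp: span_singleton)
  then show ?thesis using that assms(2) by (cases "k = 0") auto
qed

lemma span_singleton_scaleR:
  fixes v :: "'a::real_vector" assumes "k \<noteq> 0" shows "span {k *\<^sub>R v} = span {v}"
  using span_image_scale[of "{v}" "\<lambda>_. k"] assms by simp

lemma proj_map_span: "v \<noteq> 0 \<Longrightarrow> proj_map M (span {v}) = span {M *v v}"
  by (simp add: proj_map_def span_singleton_in_projective_space linear_span_image[symmetric])

lemma proj_map_scaleR:
  assumes "c \<noteq> 0" shows "proj_map (c *\<^sub>R M) = proj_map M"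
proof
  fix l
  show "proj_map (c *\<^sub>R M) l = proj_map M l"
  proof (cases "l \<in> projective_space")
    case True
    then obtain v where "v \<noteq> 0" "l = span {v}" by (rule projective_space_cases)
    then show ?thesis
      using assms by (simp add: proj_map_span span_singleton_scaleR flip: scaleR_matrix_vector_assoc)
  qed (simp add: proj_map_def)
qed

lemma proj_map_mult:
  assumes "invertible M'" shows "proj_map (M ** M') = compose projective_space (proj_map M) (proj_map M')"
proof
  fix l
  show "proj_map (M ** M') l = compose projective_space (proj_map M) (proj_map M') l"
  proof (cases "l \<in> projective_space")
    case True
    then obtain v where v: "v \<noteq> 0" "l = span {v}" by (rule projective_space_cases)
    then show ?thesis
      using True by (simp add: compose_def proj_map_span matrix_vector_mul_assoc
          invertible_mult_nonzero[OF assms])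
  qed (simp add: proj_map_def compose_def)
qed

text \<open>
  Equality of the homographies makes \<open>M *v v\<close> a multiple of \<open>M' *v v\<close> for each \<open>v\<close> separately. Comparing the
  factors for \<open>v\<close>, \<open>e\<close> and \<open>v + e\<close> shows that they all equal \<open>1\<close>.
\<close>

lemma proj_map_inj_fixed_vector:
  assumes eq: "proj_map M = proj_map M'" and inv: "invertible M'" "invertible M"
    and e: "e \<noteq> 0" "M *v e = e" "M' *v e = e"
  shows "M = M'"
proof -
  have scale: "\<exists>k. M *v v = k *\<^sub>R (M' *v v)" for v
  proof (cases "v = 0")
    case False
    then have "span {M *v v} = span {M' *v v}" using eq proj_map_span by metis
    moreover have "M *v v \<noteq> 0" using False by (intro invertible_mult_nonzero inv)
    ultimately show ?thesis using span_singleton_eqD by metis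
  qed auto
  have off: "M *v v = M' *v v" if v: "v \<notin> span {e}" for v
  proof -
    obtain k where k: "M *v v = k *\<^sub>R (M' *v v)" using scale by blast
    obtain r where r: "M *v (v + e) = r *\<^sub>R (M' *v (v + e))" using scale by blast
    have "k *\<^sub>R (M' *v v) + M' *v e = r *\<^sub>R (M' *v v) + r *\<^sub>R (M' *v e)"
      using r k e by (simp add: matrix_vector_right_distrib scaleR_add_right)
    then have "M' *v ((k - r) *\<^sub>R v) = M' *v ((r - 1) *\<^sub>R e)"
      by (simp add: matrix_vector_mult_scaleR algebra_simps)
    then have ve: "(k - r) *\<^sub>R v = (r - 1) *\<^sub>R e" using inj_matrix_vector_mult[OF inv(1)] by (metis injD)
    have "k = r"
    proof (rule ccontr)
      assume "k \<noteq> r"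
      then have "v = ((r - 1) / (k - r)) *\<^sub>R e" using ve
        by (metis (no_types, lifting) divide_inverse_commute eq_iff_diff_eq_0 left_inverse scaleR_one scaleR_scaleR)
      then show False using v by (auto simp: span_singleton)
    qed
    then have "k = 1" using ve e(1) by simp
    then show ?thesis using k by simp
  qed
  have "M *v v = M' *v v" for v
  proof (cases "v \<in> span {e}")
    case True
    then show ?thesis using e by (auto simp: span_singleton matrix_vector_mult_scaleR)
  qed (rule off)
  then show ?thesis by (simp add: matrix_eq)
qed

section \<open>Tube coordinates and the orientation conditions\<close>

text \<open>
  The vector spanning \<open>planar_point x\<close>; it also serves as the planar part of the vector that
  \<open>affine_param\<close> feeds to its frame.
\<close>

definition affine_coord_vector :: "real^2 \<Rightarrow> real^3" where
  "affine_coord_vector x = vector [x$1, x$2, 1]"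

text \<open>
  Splits \<open>real^4\<close> into a planar part in homogeneous coordinates and a vertical coordinate. The latter sits
  in the third place and the homogenizing coordinate comes last, as in \<open>affine_param\<close>.
\<close>

definition lift :: "real^3 \<Rightarrow> real \<Rightarrow> real^4" where
  "lift v z = vector [v$1, v$2, z, v$3]"

lemma affine_coord_vector_nth [simp]:
  "affine_coord_vector x $ 1 = x $ 1" "affine_coord_vector x $ 2 = x $ 2"
  "affine_coord_vector x $ 3 = 1"
  by (simp_all add: affine_coord_vector_def)

lemma lift_nth [simp]:
  "lift v z $ 1 = v $ 1" "lift v z $ 2 = v $ 2" "lift v z $ 3 = z" "lift v z $ 4 = v $ 3"
  by (simp_all add: lift_def vector_4)

lemma affine_coord_vector_nonzero: "affine_coord_vector x \<noteq> 0"
  by (metis affine_coord_vector_nth(3) zero_index zero_neq_one)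

lemma affine_coord_vector_cases:
  assumes "v $ 3 \<noteq> 0" obtains x where "v = v $ 3 *\<^sub>R affine_coord_vector x"
proof
  show "v = v $ 3 *\<^sub>R affine_coord_vector (vector [v$1 / v$3, v$2 / v$3])"
    using assms by (simp add: vec_eq_iff forall_3)
qed

lemma lift_cases: obtains v z where "u = lift v z"
proof
  show "u = lift (vector [u$1, u$2, u$4]) (u$3)" by (simp add: vec_eq_iff forall_4)
qed

lemma scaleR_lift: "k *\<^sub>R lift v z = lift (k *\<^sub>R v) (k * z)"
  by (simp add: vec_eq_iff forall_4)

lemma lift_eq_iff: "lift v z = lift v' z' \<longleftrightarrow> v = v' \<and> z = z'"
  by (auto simp: vec_eq_iff forall_4 forall_3)

lemma lift_nonzero: "v \<noteq> 0 \<Longrightarrow> lift v z \<noteq> 0"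
  by (auto simp: vec_eq_iff forall_4 forall_3)

lemma planar_point_eq: "planar_point x = span {affine_coord_vector x}"
  by (simp add: planar_point_def affine_coord_vector_def)

lemma affine_param_eq: "affine_param N x z = span {N *v lift (affine_coord_vector x) z}"
  by (simp add: affine_param_def lift_def)

text \<open>
  Affine coordinates of a point are unique, stated for arbitrary homogeneous representatives.
\<close>

lemma affine_param_span_eq:
  assumes N: "invertible N" and eq: "span {N *v lift v z} = affine_param N x z'"
  obtains k where "k \<noteq> 0" "v = k *\<^sub>R affine_coord_vector x" "z = k * z'"
proof -
  have "N *v lift (affine_coord_vector x) z' \<noteq> 0"
    by (intro invertible_mult_nonzero N lift_nonzero affine_coord_vector_nonzero)
  moreover have "span {N *v lift (affine_coord_vector x) z'} = span {N *v lift v z}"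
    using eq by (simp add: affine_param_eq)
  ultimately obtain c where c: "c \<noteq> 0"
      "N *v lift (affine_coord_vector x) z' = c *\<^sub>R (N *v lift v z)"
    using span_singleton_eqD by metis
  then have "N *v lift (affine_coord_vector x) z' = N *v lift (c *\<^sub>R v) (c * z)"
    by (simp add: matrix_vector_mult_scaleR flip: scaleR_lift)
  then have "lift (affine_coord_vector x) z' = lift (c *\<^sub>R v) (c * z)"
    using inj_matrix_vector_mult[OF N] by (rule injD[rotated])
  then have "affine_coord_vector x = c *\<^sub>R v" "z' = c * z" by (simp_all add: lift_eq_iff)
  then show ?thesis using c by (intro that[of "1 / c"]) auto
qed

text \<open>
  The homography of the plane given by \<open>G\<close>, read in the affine chart.
\<close>

definition planar_map :: "real^3^3 \<Rightarrow> real^2 \<Rightarrow> real^2" where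
  "planar_map G x = vector [(G *v affine_coord_vector x) $ 1 / (G *v affine_coord_vector x) $ 3,
                            (G *v affine_coord_vector x) $ 2 / (G *v affine_coord_vector x) $ 3]"

lemma planar_map_homogeneous:
  assumes "(G *v affine_coord_vector x) $ 3 \<noteq> 0"
  shows "G *v affine_coord_vector x =
    (G *v affine_coord_vector x) $ 3 *\<^sub>R affine_coord_vector (planar_map G x)"
  using assms by (simp add: vec_eq_iff forall_3 planar_map_def)

text \<open>
  Each of the two quotients contributes a factor \<open>1 / L\<^sup>2\<close>, where \<open>L\<close> is the third homogeneous
  coordinate of the image; the numerator of the Jacobian determinant equals \<open>L\<close> times \<open>det G\<close>, because
  the values of the three linear forms at \<open>x\<close> are the third column of \<open>G\<close> up to the other two columns.
\<close>

lemma planar_map_derivative: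
  assumes nz: "(G *v affine_coord_vector x) $ 3 \<noteq> 0"
  obtains D where "(planar_map G has_derivative D) (at x)"
    "det (matrix D) = det G / ((G *v affine_coord_vector x) $ 3) ^ 3"
proof -
  define l where "l i y = G$i$1 * y$1 + G$i$2 * y$2 + G$i$3" for i and y :: "real^2"
  have l: "(G *v affine_coord_vector y) $ i = l i y" for i y
    by (simp add: matrix_vector_mult_def sum_3 l_def)
  define d where "d i h = G$i$1 * h$1 + G$i$2 * h$2" for i and h :: "real^2"
  have dl: "(l i has_derivative d i) (at x)" for i
    unfolding l_def[abs_def] d_def[abs_def]
    by (auto intro!: derivative_eq_intros bounded_linear.has_derivative[OF bounded_linear_vec_nth])
  have nz: "l 3 x \<noteq> 0" using nz by (simp add: l)
  define q where "q i h = (d i h * l 3 x - l i x * d 3 h) / (l 3 x * l 3 x)" for i h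
  have dq: "((\<lambda>y. l i y / l 3 y) has_derivative q i) (at x)" for i
    using has_derivative_divide'[OF dl[of i] dl[of 3] nz] by (simp add: q_def[abs_def])
  define D where "D h = q 1 h *\<^sub>R axis 1 1 + q 2 h *\<^sub>R (axis 2 1 :: real^2)" for h
  have F: "planar_map G = (\<lambda>y. (l 1 y / l 3 y) *\<^sub>R axis 1 1 + (l 2 y / l 3 y) *\<^sub>R axis 2 1)"
    by (rule ext) (simp add: planar_map_def l vec_eq_iff forall_2 axis_def)
  have "(planar_map G has_derivative D) (at x)"
    unfolding F D_def[abs_def]
    by (intro has_derivative_add bounded_linear.has_derivative[OF bounded_linear_scaleR_left] dq)
  moreover have "det (matrix D) = det G / (l 3 x) ^ 3"
  proof -
    define A B L where "A = l 1 x" "B = l 2 x" "L = l 3 x"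
    have L: "L \<noteq> 0" using nz by (simp add: A_B_L_def)
    have entry: "q i (axis 1 1) = (G$i$1 * L - l i x * G$3$1) / L\<^sup>2"
        "q i (axis 2 1) = (G$i$2 * L - l i x * G$3$2) / L\<^sup>2" for i
      by (simp_all add: q_def d_def axis_def A_B_L_def power2_eq_square)
    have "det (matrix D) = q 1 (axis 1 1) * q 2 (axis 2 1) - q 1 (axis 2 1) * q 2 (axis 1 1)"
      by (simp add: det_2 matrix_def D_def axis_def)
    also have "\<dots> = ((G$1$1 * L - A * G$3$1) * (G$2$2 * L - B * G$3$2)
         - (G$1$2 * L - A * G$3$2) * (G$2$1 * L - B * G$3$1)) / L ^ 4"
      unfolding entry by (simp add: A_B_L_def diff_divide_distrib[symmetric] flip: power_add)
    also have "\<dots> = L * (L * (G$1$1 * G$2$2 - G$1$2 * G$2$1)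
         - A * (G$3$1 * G$2$2 - G$3$2 * G$2$1) - B * (G$1$1 * G$3$2 - G$1$2 * G$3$1)) / L ^ 4"
      by (simp add: algebra_simps)
    also have "\<dots> = (L * (G$1$1 * G$2$2 - G$1$2 * G$2$1)
         - A * (G$3$1 * G$2$2 - G$3$2 * G$2$1) - B * (G$1$1 * G$3$2 - G$1$2 * G$3$1)) / L ^ 3"
      using L by (simp add: eval_nat_numeral)
    also have "L * (G$1$1 * G$2$2 - G$1$2 * G$2$1)
         - A * (G$3$1 * G$2$2 - G$3$2 * G$2$1) - B * (G$1$1 * G$3$2 - G$1$2 * G$3$1) = det G"
      by (simp add: det_3 A_B_L_def l_def algebra_simps)
    finally show ?thesis by (simp add: A_B_L_def)
  qed
  ultimately show ?thesis using that by (simp add: l)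
qed

text \<open>
  The matrix that \<open>K\<close> induces modulo the third axis, when this axis is an eigendirection of \<open>K\<close>.
\<close>

definition quotient_block :: "real^4^4 \<Rightarrow> real^3^3" where
  "quotient_block K = vector [vector [K$1$1, K$1$2, K$1$4], vector [K$2$1, K$2$2, K$2$4],
     vector [K$4$1, K$4$2, K$4$4]]"

lemma vertical_eigenvector_block:
  fixes K :: "real^4^4"
  assumes "K *v axis 3 1 = c *\<^sub>R axis 3 1"
  shows "K *v lift v z = lift (quotient_block K *v v)
           (K$3$1 * v$1 + K$3$2 * v$2 + K$3$4 * v$3 + c * z)"
    and "det K = c * det (quotient_block K)"
proof -
  have "K $ i $ 3 = (c *\<^sub>R axis 3 1) $ i" for i
    unfolding assms[symmetric] by (simp add: matrix_4_mult axis_def)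
  then have col: "K$1$3 = 0" "K$2$3 = 0" "K$3$3 = c" "K$4$3 = 0"
    by (simp_all add: axis_def)
  show "K *v lift v z = lift (quotient_block K *v v)
           (K$3$1 * v$1 + K$3$2 * v$2 + K$3$4 * v$3 + c * z)"
    by (simp add: vec_eq_iff forall_4 matrix_4_mult matrix_3_mult quotient_block_def col)
  show "det K = c * det (quotient_block K)"
    by (simp add: det_4 det_3 col quotient_block_def algebra_simps)
qed

text \<open>
  In tube coordinates a transformation with vertical eigenvalue \<open>c\<close> has the form
  \<open>(x, z) \<mapsto> (planar_map G x, (c * z + \<dots>) / l x)\<close>, where \<open>G\<close> is the quotient block and \<open>l\<close> its
  third homogeneous coordinate. It is increasing on vertical lines iff \<open>c / l x > 0\<close>, and the planar
  part has Jacobian \<open>det G / l x ^ 3\<close>. As \<open>det M = c * det G\<close>, given the first condition the second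
  one becomes \<open>det M > 0\<close>, which involves neither the coordinates nor the point.
\<close>

lemma preserves_tube_orientations_iff:
  assumes N: "invertible N" and MN: "M ** N = N ** K"
    and K: "K *v axis 3 1 = c *\<^sub>R axis 3 1"
    and \<Omega>: "open \<Omega>" "\<Omega> \<noteq> {}"
  shows "preserves_tube_orientations N \<Omega> (proj_map M) \<longleftrightarrow>
     det M > 0 \<and> (\<forall>x\<in>\<Omega>. c * (quotient_block K *v affine_coord_vector x) $ 3 > 0)"
proof -
  define G where "G = quotient_block K"
  define l where "l x = (G *v affine_coord_vector x) $ 3" for x
  define s where "s x z = K$3$1 * x$1 + K$3$2 * x$2 + K$3$4 + c * z" for x :: "real^2" and z
  have act: "proj_map M (affine_param N x z) = span {N *v lift (G *v affine_coord_vector x) (s x z)}" for x z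
  proof -
    have "N *v lift (affine_coord_vector x) z \<noteq> 0"
      by (intro invertible_mult_nonzero N lift_nonzero affine_coord_vector_nonzero)
    then have "proj_map M (affine_param N x z) = span {(M ** N) *v lift (affine_coord_vector x) z}"
      by (simp add: affine_param_eq proj_map_span matrix_vector_mul_assoc)
    then show ?thesis
      using vertical_eigenvector_block(1)[OF K, of "affine_coord_vector x" z]
      by (simp add: MN G_def s_def flip: matrix_vector_mul_assoc)
  qed
  have eqD: "l x \<noteq> 0 \<and> y = planar_map G x \<and> z' = s x z / l x"
    if eq: "proj_map M (affine_param N x z) = affine_param N y z'" for x y z z'
  proof -
    obtain k where k: "k \<noteq> 0" "G *v affine_coord_vector x = k *\<^sub>R affine_coord_vector y" "s x z = k * z'"
      using affine_param_span_eq[OF N, of "G *v affine_coord_vector x" "s x z" y z'] eq unfolding act by metis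
    then have "l x = k" by (simp add: l_def)
    then show ?thesis using k by (simp add: vec_eq_iff forall_2 planar_map_def)
  qed
  have eqI: "proj_map M (affine_param N x z) = affine_param N (planar_map G x) (s x z / l x)"
    if lx: "l x \<noteq> 0" for x z
  proof -
    have "lift (G *v affine_coord_vector x) (s x z) =
        l x *\<^sub>R lift (affine_coord_vector (planar_map G x)) (s x z / l x)"
      using planar_map_homogeneous[of G x] lx by (simp add: scaleR_lift l_def)
    then show ?thesis
      using lx unfolding act unfolding affine_param_eq
      by (simp add: matrix_vector_mult_scaleR span_singleton_scaleR)
  qed
  have mono_iff: "strict_mono (\<lambda>z. s x z / l x) \<longleftrightarrow> c * l x > 0" if "l x \<noteq> 0" for x
  proof
    assume "strict_mono (\<lambda>z. s x z / l x)"
    then have "s x 0 / l x < s x 1 / l x" by (rule strict_monoD) simp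
    then have "c / l x > 0" by (simp add: s_def add_divide_distrib)
    then show "c * l x > 0" by (simp add: zero_less_divide_iff zero_less_mult_iff)
  next
    assume "c * l x > 0"
    then have "c / l x > 0" by (simp add: zero_less_divide_iff zero_less_mult_iff)
    then have "c / l x * z < c / l x * z'" if "z < z'" for z z' using that by (intro mult_strict_left_mono)
    then show "strict_mono (\<lambda>z. s x z / l x)"
      by (auto intro!: strict_monoI simp: s_def add_divide_distrib)
  qed
  \<comment> \<open>\<open>K\<close> is conjugate to \<open>M\<close> by the frame.\<close>
  have detM: "det M = c * det G"
  proof -
    have "det M * det N = det N * det K" using MN by (metis det_mul)
    moreover have "det N \<noteq> 0" using N invertible_det_nz by blast
    ultimately show ?thesis using vertical_eigenvector_block(2)[OF K] by (simp add: G_def)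
  qed
  have det_pos: "det M > 0 \<longleftrightarrow> det G / l x ^ 3 > 0" if "c * l x > 0" for x
    using that unfolding detM
    by (auto simp: zero_less_mult_iff zero_less_divide_iff zero_less_power_eq)
  show ?thesis
  proof
    assume "preserves_tube_orientations N \<Omega> (proj_map M)"
    then obtain f where
      f1: "\<forall>x\<in>\<Omega>. \<exists>g :: real \<Rightarrow> real. strict_mono g \<and>
            (\<forall>z. proj_map M (affine_param N x z) = affine_param N (f x) (g z))" and
      f2: "\<forall>x\<in>\<Omega>. \<exists>D. (f has_derivative D) (at x) \<and> det (matrix D) > 0"
      unfolding preserves_tube_orientations_def by blast
    have f: "f x = planar_map G x \<and> c * l x > 0" if x: "x \<in> \<Omega>" for x
    proof -
      obtain g where g: "strict_mono g" "\<And>z. proj_map M (affine_param N x z) = affine_param N (f x) (g z)"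
        using f1 x by blast
      have "l x \<noteq> 0" "f x = planar_map G x" "\<And>z. g z = s x z / l x" using eqD[OF g(2)] by blast+
      moreover from this have "g = (\<lambda>z. s x z / l x)" by auto
      ultimately show ?thesis using g(1) mono_iff by simp
    qed
    obtain x where x: "x \<in> \<Omega>" using \<Omega> by blast
    obtain D where D: "(f has_derivative D) (at x)" "det (matrix D) > 0" using f2 x by blast
    \<comment> \<open>\<open>f\<close> is arbitrary outside \<open>\<Omega>\<close>, but its derivative at \<open>x\<close> only depends on its values near \<open>x\<close>.\<close>
    have "(planar_map G has_derivative D) (at x)"
      using has_derivative_transform_within_open[OF D(1) \<Omega>(1) x] f by simp
    moreover have lx: "l x \<noteq> 0" using f[OF x] by auto
    ultimately have "det (matrix D) = det G / l x ^ 3"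
      using planar_map_derivative[of G x] by (metis has_derivative_unique l_def)
    then have "det M > 0" using D det_pos f x by auto
    then show "det M > 0 \<and> (\<forall>x\<in>\<Omega>. c * (quotient_block K *v affine_coord_vector x) $ 3 > 0)"
      using f by (simp add: l_def G_def)
  next
    assume "det M > 0 \<and> (\<forall>x\<in>\<Omega>. c * (quotient_block K *v affine_coord_vector x) $ 3 > 0)"
    then have pos: "det M > 0" "\<And>x. x \<in> \<Omega> \<Longrightarrow> c * l x > 0" by (auto simp: l_def G_def)
    then have nz: "x \<in> \<Omega> \<Longrightarrow> l x \<noteq> 0" for x by fastforce
    show "preserves_tube_orientations N \<Omega> (proj_map M)"
      unfolding preserves_tube_orientations_def
    proof (rule exI[of _ "planar_map G"], intro conjI ballI)
      fix x assume x: "x \<in> \<Omega>"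
      show "\<exists>g. strict_mono g \<and>
          (\<forall>z. proj_map M (affine_param N x z) = affine_param N (planar_map G x) (g z))"
        using mono_iff eqI nz pos x by (intro exI[of _ "\<lambda>z. s x z / l x"]) auto
      show "\<exists>D. (planar_map G has_derivative D) (at x) \<and> det (matrix D) > 0"
        using planar_map_derivative[of G x] nz[OF x] det_pos[of x] pos x unfolding l_def by metis
    qed
  qed
qed

section \<open>The tube of spacelike planes\<close>

definition dual_tube :: "(real^3) set \<Rightarrow> (real^4) set set" where
  "dual_tube C = {span {homog a s} |a s. a \<in> dual_cone C}"

text \<open>
  A form without zeros on the connected set \<open>closure C - {0}\<close> has constant sign there; changing the sign of
  the equation puts it in the dual cone.
\<close>

lemma spacelike_plane_cases:
  assumes C: "proper_convex_cone C" and H: "H \<in> spacelike_planes C"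
  obtains a b where "a \<in> dual_cone C" "H = {Y. a \<bullet> Y = b}"
proof -
  obtain a b where ab: "a \<noteq> 0" "H = {Y. a \<bullet> Y = b}"
    using H by (auto simp: spacelike_planes_def affine_plane_iff)
  have nz: "a \<bullet> x \<noteq> 0" if "x \<in> closure C - {0}" for x
    using H that ab direction_plane by (auto simp: spacelike_planes_def)
  have conn: "connected ((\<lambda>x. a \<bullet> x) ` (closure C - {0}))"
    by (intro connected_continuous_image continuous_intros convex_connected
        convex_closure_minus_zero[OF C])
  have "(\<forall>x\<in>closure C - {0}. a \<bullet> x > 0) \<or> (\<forall>x\<in>closure C - {0}. a \<bullet> x < 0)"
  proof (rule ccontr)
    assume "\<not> ?thesis"
    then obtain x y where "x \<in> closure C - {0}" "y \<in> closure C - {0}" "a \<bullet> x \<le> 0" "0 \<le> a \<bullet> y"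
      by (meson linorder_not_less)
    then have "0 \<in> (\<lambda>x. a \<bullet> x) ` (closure C - {0})"
      using connectedD_interval[OF conn] by (meson imageI)
    then show False using nz by force
  qed
  then consider "a \<in> dual_cone C" | "- a \<in> dual_cone C" by (auto simp: dual_cone_def)
  then show ?thesis
  proof cases
    case 1 then show ?thesis using ab that by blast
  next
    case 2
    moreover have "H = {Y. - a \<bullet> Y = - b}" using ab by auto
    ultimately show ?thesis using that by blast
  qed
qed

lemma spacelike_planeI:
  assumes C: "proper_convex_cone C" and a: "a \<in> dual_cone C"
  shows "{Y. a \<bullet> Y = b} \<in> spacelike_planes C"
proof -
  have a0: "a \<noteq> 0" using zero_notin_dual_cone[OF C] a by blast
  have "0 \<in> closure C"
  proof -
    obtain x where x: "x \<in> C" using C by (auto simp: proper_convex_cone_def)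
    have "(\<lambda>n. (1 / real (Suc n)) *\<^sub>R x) \<longlonglongrightarrow> 0 *\<^sub>R x"
      by (intro tendsto_intros LIMSEQ_Suc lim_1_over_n)
    moreover have "(1 / real (Suc n)) *\<^sub>R x \<in> C" for n
      using C x by (simp add: proper_convex_cone_def)
    ultimately show ?thesis
      unfolding closure_sequential by (auto intro!: exI[of _ "\<lambda>n. (1 / real (Suc n)) *\<^sub>R x"])
  qed
  moreover have "x = 0" if "x \<in> closure C" "a \<bullet> x = 0" for x
  proof (rule ccontr)
    assume "x \<noteq> 0"
    then have "a \<bullet> x > 0" using a that(1) by (simp add: dual_cone_def)
    then show False using that(2) by simp
  qed
  ultimately have "{v. a \<bullet> v = 0} \<inter> closure C = {0}" by auto
  moreover have "affine_plane {Y. a \<bullet> Y = b}" using a0 unfolding affine_plane_iff by blast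
  ultimately show ?thesis by (simp add: spacelike_planes_def direction_plane[OF a0])
qed

lemma dual_points_spacelike:
  assumes C: "proper_convex_cone C"
  shows "dual_point ` spacelike_planes C = dual_tube C"
proof (intro equalityI subsetI)
  fix l assume "l \<in> dual_point ` spacelike_planes C"
  then obtain H where H: "H \<in> spacelike_planes C" "l = dual_point H" by blast
  obtain a b where ab: "a \<in> dual_cone C" "H = {Y. a \<bullet> Y = b}"
    using spacelike_plane_cases[OF C H(1)] .
  moreover have "a \<noteq> 0" using zero_notin_dual_cone[OF C] ab by blast
  ultimately show "l \<in> dual_tube C"
    using H by (auto simp: dual_tube_def dual_point_plane)
next
  fix l assume "l \<in> dual_tube C"
  then obtain a s where a: "a \<in> dual_cone C" "l = span {homog a s}" by (auto simp: dual_tube_def)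
  moreover have "a \<noteq> 0" using zero_notin_dual_cone[OF C] a by blast
  ultimately have "l = dual_point {Y. a \<bullet> Y = - s}" by (simp add: dual_point_plane)
  then show "l \<in> dual_point ` spacelike_planes C" using spacelike_planeI[OF C a(1)] by blast
qed

text \<open>
  A line determines its spanning vector only up to a nonzero scalar. Positivity at \<open>w\<close> removes the
  ambiguity of sign, and membership in the dual cone is then invariant under the remaining scaling.
\<close>

lemma span_homog_in_dual_tube:
  assumes C: "proper_convex_cone C" and w: "w \<in> C" and pos: "w \<bullet> a > 0"
  shows "span {homog a s} \<in> dual_tube C \<longleftrightarrow> a \<in> dual_cone C"
proof
  assume "span {homog a s} \<in> dual_tube C"
  then obtain b t where b: "b \<in> dual_cone C" "span {homog a s} = span {homog b t}"
    by (auto simp: dual_tube_def)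
  have "homog a s \<noteq> 0" using pos by (intro homog_nonzero) auto
  then obtain k where k: "homog a s = k *\<^sub>R homog b t" using b(2) span_singleton_eqD by metis
  then have a: "a = k *\<^sub>R b" by (simp add: homog_scaleR homog_eq_iff)
  then have "k > 0" using pos dual_cone_pos[OF C b(1) w] by (simp add: zero_less_mult_iff)
  then show "a \<in> dual_cone C" using a b dual_cone_scale by blast
next
  assume "a \<in> dual_cone C"
  then show "span {homog a s} \<in> dual_tube C" unfolding dual_tube_def by blast
qed

text \<open>
  Dropping the third column and the last row of \<open>N\<close> gives the linear map from planar homogeneous
  coordinates to the normal vectors of planes, for \<open>N\<close> whose third column is the vertical
  direction \<open>homog 0 c\<close>.
\<close>

definition base_frame :: "real^4^4 \<Rightarrow> real^3^3" where
  "base_frame N = vector [vector [N$1$1, N$1$2, N$1$4], vector [N$2$1, N$2$2, N$2$4],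
     vector [N$3$1, N$3$2, N$3$4]]"

lemma vertical_frame_block:
  fixes N :: "real^4^4"
  assumes "N *v axis 3 1 = homog 0 c"
  shows "\<exists>s. N *v lift v z = homog (base_frame N *v v) s"
    and "det N = - c * det (base_frame N)"
proof -
  have "N $ i $ 3 = homog 0 c $ i" for i
    unfolding assms[symmetric] by (simp add: matrix_4_mult axis_def)
  then have col: "N$1$3 = 0" "N$2$3 = 0" "N$3$3 = 0" "N$4$3 = c"
    by (simp_all add: homog_def vector_4)
  show "\<exists>s. N *v lift v z = homog (base_frame N *v v) s"
    by (rule exI[of _ "(N *v lift v z) $ 4"])
      (simp add: vec_eq_iff forall_4 homog_def vector_4 matrix_4_mult matrix_3_mult base_frame_def col)
  show "det N = - c * det (base_frame N)"
    by (simp add: det_4 det_3 col base_frame_def algebra_simps)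
qed

lemma dual_hyperplane_span:
  "dual_hyperplane (span {w}) = {u. u \<bullet> homog w 0 = 0}"
proof -
  have scale: "homog (k *\<^sub>R w) 0 = k *\<^sub>R homog w 0" for k by (simp add: homog_scaleR)
  have "w \<in> span {w}" by (simp add: span_base)
  then show ?thesis
    by (auto simp: dual_hyperplane_def span_singleton[of w] scale)
qed

text \<open>
  The frame sends the hyperplane of vanishing last coordinate to the forms vanishing at \<open>w\<close>. Evaluation
  at \<open>w\<close> is therefore a multiple \<open>k\<close> of the last coordinate, and \<open>k \<noteq> 0\<close> because the frame is
  invertible.
\<close>

lemma polarized_coordinates_dual:
  assumes N: "polarized_coordinates (dual_hyperplane (span {w})) dual_point_infinity N"
    and w: "w \<noteq> 0"
  obtains k c where "k \<noteq> 0" "N *v axis 3 1 = homog 0 c" "invertible (base_frame N)"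
    "\<And>v. w \<bullet> (base_frame N *v v) = k * v $ 3"
proof -
  have inv: "invertible N"
    and E: "(*v) N ` {u. u $ 4 = 0} = {u. u \<bullet> homog w 0 = 0}"
    and q: "span {N *v axis 3 1} = span {homog 0 1}"
    using N by (auto simp: polarized_coordinates_def dual_hyperplane_span dual_point_infinity_eq)
  have "N *v axis 3 1 \<noteq> 0" using inv by (intro invertible_mult_nonzero) (auto simp: axis_eq_0_iff)
  then obtain c where c: "c \<noteq> 0" "N *v axis 3 1 = c *\<^sub>R homog 0 1" using q span_singleton_eqD by metis
  then have c3: "N *v axis 3 1 = homog 0 c" by (simp add: homog_scaleR)
  have "det (base_frame N) \<noteq> 0"
    using vertical_frame_block(2)[OF c3] inv by (auto simp: invertible_det_nz)
  then have P: "invertible (base_frame N)" by (simp add: invertible_det_nz)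
  define k where "k = w \<bullet> (base_frame N *v axis 3 1)"
  have k: "w \<bullet> (base_frame N *v v) = k * v $ 3" for v
  proof -
    define v' where "v' = v - v $ 3 *\<^sub>R axis 3 1"
    obtain s where s: "N *v lift v' 0 = homog (base_frame N *v v') s"
      using vertical_frame_block(1)[OF c3] by blast
    have "N *v lift v' 0 \<in> {u. u \<bullet> homog w 0 = 0}"
      unfolding E[symmetric] by (intro imageI) (simp add: v'_def axis_def)
    then have "w \<bullet> (base_frame N *v v') = 0"
      by (simp add: s homog_inner inner_commute)
    then show ?thesis
      by (simp add: v'_def k_def matrix_vector_mult_diff_distrib matrix_vector_mult_scaleR inner_diff_right)
  qed
  have "k \<noteq> 0"
  proof
    assume "k = 0"
    have "w = base_frame N *v (matrix_inv (base_frame N) *v w)"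
      by (simp add: matrix_vector_mul_assoc matrix_inv[OF P])
    then have "w \<bullet> w = 0" using k[of "matrix_inv (base_frame N) *v w"] \<open>k = 0\<close> by simp
    then show False using w by simp
  qed
  then show ?thesis using that c3 P k by blast
qed

text \<open>
  Whatever the tube coordinates, the planar domain is a linear copy of the section \<open>w \<bullet> a = 1\<close>. The frame
  multiplies the normalisation by the constant \<open>k\<close>, whose sign is arbitrary, so that dividing by it is what
  selects the dual cone instead of its negative.
\<close>

lemma tube_coordinates_dual_tube:
  assumes C: "proper_convex_cone C" and w: "w \<in> C"
    and coords: "tube_coordinates (dual_hyperplane (span {w})) dual_point_infinity (dual_tube C) N \<Omega>"
  obtains k c where "k \<noteq> 0" "N *v axis 3 1 = homog 0 c" "invertible (base_frame N)"
    "\<forall>v. w \<bullet> (base_frame N *v v) = k * v $ 3"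
    "{a \<in> dual_cone C. w \<bullet> a = 1} = (\<lambda>x. (1 / k) *\<^sub>R (base_frame N *v affine_coord_vector x)) ` \<Omega>"
proof -
  have N: "polarized_coordinates (dual_hyperplane (span {w})) dual_point_infinity N"
    using coords by (simp only: tube_coordinates_def)
  have T: "dual_tube C = {affine_param N x z |x z. x \<in> \<Omega>}"
    using coords by (simp only: tube_coordinates_def)
  have inv: "invertible N" using N by (simp add: polarized_coordinates_def)
  obtain k c where k: "k \<noteq> 0" and c3: "N *v axis 3 1 = homog 0 c"
    and P: "invertible (base_frame N)" and wP: "\<And>v. w \<bullet> (base_frame N *v v) = k * v $ 3"
    using polarized_coordinates_dual[OF N nonzero_cone[OF C w]] by metis
  let ?a = "\<lambda>x. (1 / k) *\<^sub>R (base_frame N *v affine_coord_vector x)"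
  have w1: "w \<bullet> ?a x = 1" for x using k by (simp add: wP)
  have mem: "?a x \<in> dual_cone C \<longleftrightarrow> x \<in> \<Omega>" for x
  proof -
    obtain s where s: "N *v lift (affine_coord_vector x) 0 = homog (base_frame N *v affine_coord_vector x) s"
      using vertical_frame_block(1)[OF c3] by blast
    have "affine_param N x 0 = span {(1 / k) *\<^sub>R (N *v lift (affine_coord_vector x) 0)}"
      using k by (simp add: affine_param_eq span_singleton_scaleR)
    also have "\<dots> = span {homog (?a x) (s / k)}" by (simp add: s homog_scaleR)
    finally have "?a x \<in> dual_cone C \<longleftrightarrow> affine_param N x 0 \<in> dual_tube C"
      using span_homog_in_dual_tube[OF C w] w1 by simp
    also have "\<dots> \<longleftrightarrow> x \<in> \<Omega>"
    proof
      assume "affine_param N x 0 \<in> dual_tube C"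
      then obtain y z where y: "y \<in> \<Omega>" "affine_param N x 0 = affine_param N y z" unfolding T by blast
      obtain k where "k \<noteq> 0" "affine_coord_vector x = k *\<^sub>R affine_coord_vector y"
        using affine_param_span_eq[OF inv] y(2) unfolding affine_param_eq[of N x] by metis
      then have "x = y" by (auto simp: vec_eq_iff forall_2 forall_3)
      then show "x \<in> \<Omega>" using y by simp
    qed (auto simp: T)
    finally show ?thesis .
  qed
  have "{a \<in> dual_cone C. w \<bullet> a = 1} = ?a ` \<Omega>"
  proof (intro equalityI subsetI)
    fix a assume a: "a \<in> {a \<in> dual_cone C. w \<bullet> a = 1}"
    define v where "v = matrix_inv (base_frame N) *v (k *\<^sub>R a)"
    have v: "base_frame N *v v = k *\<^sub>R a"
      by (simp add: v_def matrix_vector_mul_assoc matrix_inv[OF P])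
    then have "k * v $ 3 = k" using a wP[of v] by simp
    then have v3: "v $ 3 = 1" using k by simp
    then obtain x where "v = affine_coord_vector x" using affine_coord_vector_cases[of v] by auto
    then have "a = ?a x" using v k by simp
    then show "a \<in> ?a ` \<Omega>" using mem a by auto
  qed (use mem w1 in auto)
  then show ?thesis using that k c3 P wP by blast
qed

text \<open>
  Suitable coordinates come from a rotation or reflection \<open>R\<close> that takes the third axis to the direction
  of \<open>w\<close>: then \<open>w \<bullet> (R *v v)\<close> is a positive multiple of \<open>v $ 3\<close>, and \<open>R\<close> identifies the planar domain
  isometrically with a section of the dual cone.
\<close>

lemma convex_tube_domain_dual_tube:
  assumes C: "proper_convex_cone C" and w: "w \<in> C"
  shows "convex_tube_domain (dual_hyperplane (span {w})) dual_point_infinity (dual_tube C)"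
proof -
  have w0: "w \<noteq> 0" using nonzero_cone[OF C w] .
  have nw: "norm ((1 / norm w) *\<^sub>R w) = 1" using w0 by simp
  obtain R :: "real^3^3" where R: "orthogonal_matrix R" "R *v axis 3 1 = (1 / norm w) *\<^sub>R w"
    using orthogonal_matrix_exists_basis[OF nw, of 3] by blast
  obtain R' where RR: "R' ** R = mat 1" "R ** R' = mat 1"
    using R(1) by (auto simp: orthogonal_matrix_def)
  have Rinner: "(R *v u) \<bullet> (R *v v) = u \<bullet> v" for u v
    by (metis R(1) orthogonal_transformation_matrix orthogonal_transformation_def
        matrix_of_matrix_vector_mul matrix_vector_mul_linear)
  have wR: "w \<bullet> (R *v v) = norm w * v $ 3" for v
  proof -
    have "w = norm w *\<^sub>R (R *v axis 3 1)" using R(2) w0 by simp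
    then have "w \<bullet> (R *v v) = norm w * ((R *v axis 3 1) \<bullet> (R *v v))" by (metis inner_scaleR_left)
    then show ?thesis by (simp add: Rinner inner_axis')
  qed
  define N :: "real^4^4" where "N = vector [vector [R$1$1, R$1$2, 0, R$1$3],
     vector [R$2$1, R$2$2, 0, R$2$3], vector [R$3$1, R$3$2, 0, R$3$3], vector [0, 0, 1, 0]]"
  have Nlift: "N *v lift v z = homog (R *v v) z" for v z
    by (simp add: vec_eq_iff forall_4 homog_def vector_4 matrix_4_mult matrix_3_mult N_def)
  have N3: "N *v axis 3 1 = homog 0 1"
  proof -
    have "axis 3 1 = lift 0 1" by (simp add: vec_eq_iff forall_4 axis_def)
    then show ?thesis using Nlift[of 0 1] by simp
  qed
  have "base_frame N = R"
    by (simp add: vec_eq_iff forall_3 base_frame_def N_def vector_4)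
  moreover have "det R \<noteq> 0" using det_orthogonal_matrix[OF R(1)] by auto
  ultimately have inv: "invertible N"
    using vertical_frame_block(2)[OF N3] by (simp add: invertible_det_nz)
  have E: "(*v) N ` {u. u $ 4 = 0} = {u. u \<bullet> homog w 0 = 0}"
  proof (intro equalityI subsetI)
    fix u assume "u \<in> (*v) N ` {u. u $ 4 = 0}"
    then obtain y where y: "u = N *v y" "y $ 4 = 0" by auto
    obtain v z where "y = lift v z" using lift_cases .
    then show "u \<in> {u. u \<bullet> homog w 0 = 0}" using y wR[of v]
      by (simp add: Nlift homog_inner inner_commute)
  next
    fix u assume u: "u \<in> {u. u \<bullet> homog w 0 = 0}"
    obtain a z where a: "u = homog a z" using homog_cases .
    have Ra: "a = R *v (R' *v a)" by (simp add: matrix_vector_mul_assoc RR)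
    then have "(R' *v a) $ 3 = 0"
      using u wR[of "R' *v a"] w0 by (simp add: a homog_inner inner_commute)
    moreover have "u = N *v lift (R' *v a) z" using Ra by (simp add: Nlift a)
    ultimately show "u \<in> (*v) N ` {u. u $ 4 = 0}" by (intro image_eqI) auto
  qed
  define \<Omega> where "\<Omega> = {x. R *v affine_coord_vector x \<in> dual_cone C}"
  have aff: "affine_coord_vector x = x $ 1 *\<^sub>R axis 1 1 + x $ 2 *\<^sub>R axis 2 1 + axis 3 1" for x
    by (simp add: vec_eq_iff forall_3 axis_def)
  have "open \<Omega>"
  proof -
    have "\<Omega> = (\<lambda>x. R *v affine_coord_vector x) -` dual_cone C" by (auto simp: \<Omega>_def)
    moreover have "continuous_on UNIV (\<lambda>x. R *v affine_coord_vector x)"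
      unfolding aff
      by (intro linear_continuous_on_compose[OF _ matrix_vector_mul_linear] continuous_intros)
    ultimately show ?thesis
      using open_dual_cone[OF proper_convex_cone_homogeneous[OF C]] by (simp add: open_vimage)
  qed
  moreover have "convex \<Omega>"
  proof (rule convexI)
    fix x y :: "real^2" and u v :: real
    assume xy: "x \<in> \<Omega>" "y \<in> \<Omega>" and uv: "0 \<le> u" "0 \<le> v" "u + v = 1"
    have "affine_coord_vector (u *\<^sub>R x + v *\<^sub>R y) =
        u *\<^sub>R affine_coord_vector x + v *\<^sub>R affine_coord_vector y"
      using uv by (simp add: vec_eq_iff forall_3)
    then show "u *\<^sub>R x + v *\<^sub>R y \<in> \<Omega>"
      using convexD[OF convex_dual_cone _ _ uv] xy
      by (simp add: \<Omega>_def matrix_vector_right_distrib matrix_vector_mult_scaleR)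
  qed
  moreover have "bounded \<Omega>"
  proof -
    have "w \<in> dual_cone (dual_cone C)" using dual_cone_dual_cone[OF C] w by simp
    then obtain m where m: "m > 0" "\<And>a. a \<in> closure (dual_cone C) \<Longrightarrow> m * norm a \<le> w \<bullet> a"
      using dual_cone_bound[OF positively_homogeneous_dual_cone] by metis
    have "norm x \<le> norm w / m" if x: "x \<in> \<Omega>" for x
    proof -
      have "norm x \<le> norm (affine_coord_vector x)"
        by (simp add: norm_le inner_vec_def sum_2 sum_3)
      also have "\<dots> = norm (R *v affine_coord_vector x)" by (simp add: norm_eq_sqrt_inner Rinner)
      also have "\<dots> \<le> norm w / m"
        using m(2)[of "R *v affine_coord_vector x"] x closure_subset m(1) wR
        by (auto simp: \<Omega>_def field_simps)
      finally show ?thesis .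
    qed
    then show ?thesis by (auto simp: bounded_iff)
  qed
  moreover have cover: "\<exists>x\<in>\<Omega>. \<exists>k>0. a = k *\<^sub>R (R *v affine_coord_vector x)" if a: "a \<in> dual_cone C" for a
  proof -
    define v where "v = R' *v a"
    have Ra: "R *v v = a" by (simp add: v_def matrix_vector_mul_assoc RR)
    have v3: "v $ 3 > 0" using dual_cone_pos[OF C a w] wR[of v] Ra by (simp add: zero_less_mult_iff)
    then obtain x where x: "v = v $ 3 *\<^sub>R affine_coord_vector x" using affine_coord_vector_cases[of v] by auto
    then have ax: "a = v $ 3 *\<^sub>R (R *v affine_coord_vector x)"
      using Ra by (metis matrix_vector_mult_scaleR)
    then have "R *v affine_coord_vector x = (1 / v $ 3) *\<^sub>R a" using v3 by simp
    then have "x \<in> \<Omega>" using dual_cone_scale[OF a, of "1 / v $ 3"] v3 by (simp add: \<Omega>_def)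
    then show ?thesis using ax v3 by blast
  qed
  moreover have "\<Omega> \<noteq> {}" using dual_cone_nonempty[OF C] cover by blast
  moreover have "dual_tube C = {affine_param N x z |x z. x \<in> \<Omega>}"
  proof (intro equalityI subsetI)
    fix l assume "l \<in> dual_tube C"
    then obtain a s where a: "a \<in> dual_cone C" "l = span {homog a s}" by (auto simp: dual_tube_def)
    obtain x k where x: "x \<in> \<Omega>" "k > 0" "a = k *\<^sub>R (R *v affine_coord_vector x)" using cover[OF a(1)] by blast
    have "homog a s = k *\<^sub>R homog (R *v affine_coord_vector x) (s / k)" using x by (simp add: homog_scaleR)
    then have "l = affine_param N x (s / k)"
      using a x by (simp add: affine_param_eq Nlift span_singleton_scaleR)
    then show "l \<in> {affine_param N x z |x z. x \<in> \<Omega>}" using x by blast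
  qed (auto simp: affine_param_eq Nlift dual_tube_def \<Omega>_def)
  ultimately show ?thesis
    unfolding convex_tube_domain_def tube_coordinates_def polarized_coordinates_def
    using inv E N3 by (auto simp: dual_hyperplane_span dual_point_infinity_eq intro!: exI[of _ N] exI[of _ \<Omega>])
qed

text \<open>
  The homography is the inverse of the frame of the coordinates. It is compatible with taking directions
  of planes because the direction of a plane determines its normal vector up to scaling.
\<close>

lemma dual_tube_base_is_section:
  assumes C: "proper_convex_cone C" and w: "w \<in> C"
    and coords: "tube_coordinates (dual_hyperplane (span {w})) dual_point_infinity (dual_tube C) N \<Omega>"
  shows "\<exists>\<Sigma> L. section_of (dual_cone C) \<Sigma> \<and> L \<in> homographies \<and>
           L ` projectivization \<Sigma> = planar_point ` \<Omega> \<and>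
           (\<forall>H \<in> spacelike_planes C. \<forall>a \<in> \<Sigma>. \<forall>x z.
              direction H = {v. a \<bullet> v = 0} \<and> dual_point H = affine_param N x z \<longrightarrow>
              L (span {a}) = planar_point x)"
proof -
  obtain k c where k: "k \<noteq> 0" and c3: "N *v axis 3 1 = homog 0 c"
    and P: "invertible (base_frame N)" and wP: "\<forall>v. w \<bullet> (base_frame N *v v) = k * v $ 3"
    and \<Sigma>: "{a \<in> dual_cone C. w \<bullet> a = 1} = (\<lambda>x. (1 / k) *\<^sub>R (base_frame N *v affine_coord_vector x)) ` \<Omega>"
    using tube_coordinates_dual_tube[OF C w coords] .
  define \<Sigma> where "\<Sigma> = {a \<in> dual_cone C. w \<bullet> a = 1}"
  define L where "L = proj_map (matrix_inv (base_frame N))"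
  have L: "L (span {r *\<^sub>R (base_frame N *v affine_coord_vector x)}) = planar_point x" if "r \<noteq> 0" for r x
  proof -
    have "base_frame N *v affine_coord_vector x \<noteq> 0"
      by (intro invertible_mult_nonzero P affine_coord_vector_nonzero)
    then show ?thesis
      using that by (simp add: L_def proj_map_span planar_point_eq span_singleton_scaleR
          matrix_vector_mul_assoc matrix_inv[OF P])
  qed
  have is_section: "section_of (dual_cone C) \<Sigma>"
    unfolding section_of_def using w by (auto simp: \<Sigma>_def dual_cone_dual_cone[OF C])
  have homography: "L \<in> homographies"
    unfolding L_def homographies_def using matrix_inv[OF P] by (auto simp: invertible_def)
  have image: "L ` projectivization \<Sigma> = planar_point ` \<Omega>"
  proof -
    have "projectivization \<Sigma> = (\<lambda>x. span {(1 / k) *\<^sub>R (base_frame N *v affine_coord_vector x)}) ` \<Omega>"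
      unfolding projectivization_def \<Sigma>_def \<Sigma> by blast
    then show ?thesis using L[of "1 / k"] k by (simp add: image_image)
  qed
  have pointwise: "L (span {a}) = planar_point x"
    if H: "H \<in> spacelike_planes C" and a: "a \<in> \<Sigma>"
      and dir: "direction H = {v. a \<bullet> v = 0}" and eq: "dual_point H = affine_param N x z" for H a x z
  proof -
    obtain a' b where a': "a' \<in> dual_cone C" "H = {Y. a' \<bullet> Y = b}" using spacelike_plane_cases[OF C H] .
    have nz: "a' \<noteq> 0" "a \<noteq> 0" using zero_notin_dual_cone[OF C] a' a by (auto simp: \<Sigma>_def)
    \<comment> \<open>The component of \<open>a\<close> orthogonal to \<open>a'\<close> lies in the direction of \<open>H\<close>, where \<open>a\<close> vanishes as well.\<close>
    define r where "r = (a \<bullet> a') / (a' \<bullet> a')"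
    have "a' \<bullet> (a - r *\<^sub>R a') = 0" using nz by (simp add: r_def inner_diff_right inner_commute)
    then have "a \<bullet> (a - r *\<^sub>R a') = 0"
      using dir direction_plane[OF nz(1), of b] unfolding a'(2) by blast
    then have "(a - r *\<^sub>R a') \<bullet> (a - r *\<^sub>R a') = 0"
      using \<open>a' \<bullet> (a - r *\<^sub>R a') = 0\<close> by (simp only: inner_diff_left inner_scaleR_left)
    then have ar: "a = r *\<^sub>R a'" by simp
    obtain s where s: "N *v lift (affine_coord_vector x) z = homog (base_frame N *v affine_coord_vector x) s"
      using vertical_frame_block(1)[OF c3] by blast
    have "span {homog a' (- b)} = span {homog (base_frame N *v affine_coord_vector x) s}"
      using eq by (simp add: a'(2) dual_point_plane[OF nz(1)] affine_param_eq s)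
    then obtain t where "t \<noteq> 0" "homog a' (- b) = t *\<^sub>R homog (base_frame N *v affine_coord_vector x) s"
      using span_singleton_eqD homog_nonzero[OF nz(1)] by metis
    then have "a = (r * t) *\<^sub>R (base_frame N *v affine_coord_vector x)" "r * t \<noteq> 0"
      using ar nz by (auto simp: homog_scaleR homog_eq_iff)
    then show ?thesis using L by metis
  qed
  show ?thesis
    by (intro exI[of _ \<Sigma>] exI[of _ L] conjI is_section homography image ballI allI impI)
      (elim conjE, rule pointwise)
qed

section \<open>The action of the affine cone automorphisms\<close>

definition affine_matrix :: "(real^3^3) \<times> (real^3) \<Rightarrow> real^4^4" where
  "affine_matrix g = vector [homog (fst g $ 1) (snd g $ 1), homog (fst g $ 2) (snd g $ 2),
     homog (fst g $ 3) (snd g $ 3), homog 0 1]"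

lemma affine_matrix_homog:
  "affine_matrix g *v homog Y t = homog (fst g *v Y + t *\<^sub>R snd g) t"
  by (simp add: vec_eq_iff forall_4 affine_matrix_def homog_def vector_4 matrix_4_mult matrix_3_mult)

lemma det_affine_matrix: "det (affine_matrix g) = det (fst g)"
  by (simp add: det_4 det_3 affine_matrix_def homog_def vector_4 algebra_simps)

lemma affine_matrix_inj: "affine_matrix g = affine_matrix h \<Longrightarrow> g = h"
  by (simp add: vec_eq_iff forall_4 forall_3 affine_matrix_def homog_def vector_4 prod_eq_iff)

text \<open>
  A linear map of \<open>real^4\<close> that preserves the last coordinate preserves the affine space where it is \<open>1\<close>.
\<close>

lemma affine_matrix_cases:
  assumes "\<And>v. (F *v v) $ 4 = v $ 4" obtains g where "F = affine_matrix g"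
proof
  have "F $ 4 $ i = axis i 1 $ 4" for i
    using assms[of "axis i 1"] by (simp add: matrix_vector_mult_basis column_def)
  then have "F $ 4 $ 1 = 0" "F $ 4 $ 2 = 0" "F $ 4 $ 3 = 0" "F $ 4 $ 4 = 1"
    by (simp_all add: axis_def)
  then show "F = affine_matrix (vector [vector [F$1$1, F$1$2, F$1$3], vector [F$2$1, F$2$2, F$2$3],
      vector [F$3$1, F$3$2, F$3$3]], vector [F$1$4, F$2$4, F$3$4])"
    by (simp add: vec_eq_iff forall_4 affine_matrix_def homog_def vector_4)
qed

lemma affine_matrix_mult:
  "affine_matrix (fst g ** fst h, fst g *v snd h + snd g) = affine_matrix g ** affine_matrix h"
proof -
  have "affine_matrix (fst g ** fst h, fst g *v snd h + snd g) *v u =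
      (affine_matrix g ** affine_matrix h) *v u" for u
  proof -
    obtain Y t where "u = homog Y t" using homog_cases .
    then show ?thesis
      by (simp add: affine_matrix_homog matrix_vector_right_distrib matrix_vector_mult_scaleR scaleR_add_right add.assoc
          flip: matrix_vector_mul_assoc)
  qed
  then show ?thesis by (simp add: matrix_eq)
qed

text \<open>
  Planes are zero sets of forms, so they are moved by the contragredient of the matrix that moves
  points.
\<close>

definition dual_action :: "(real^3^3) \<times> (real^3) \<Rightarrow> (real^4) set \<Rightarrow> (real^4) set" where
  "dual_action g = proj_map (contragredient (affine_matrix g))"

lemma invertible_affine_matrix: "invertible (fst g) \<Longrightarrow> invertible (affine_matrix g)"
  by (simp add: invertible_det_nz det_affine_matrix)

lemma contragredient_affine_matrix:
  assumes g: "invertible (fst g)"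
  shows "contragredient (affine_matrix g) *v homog a s =
    homog (contragredient (fst g) *v a) (s - (contragredient (fst g) *v a) \<bullet> snd g)" (is "?l = ?r")
proof (rule vector_eq_rdot[THEN iffD1, rule_format])
  fix v
  define u where "u = matrix_inv (affine_matrix g) *v v"
  have v: "v = affine_matrix g *v u"
    by (simp add: u_def matrix_vector_mul_assoc matrix_inv[OF invertible_affine_matrix[OF g]])
  obtain Y t where u: "u = homog Y t" using homog_cases .
  have "?l \<bullet> v = homog a s \<bullet> homog Y t"
    unfolding v u by (rule contragredient_inner[OF invertible_affine_matrix[OF g]])
  also have "\<dots> = ?r \<bullet> v"
    by (simp add: v u affine_matrix_homog homog_inner inner_add_right contragredient_inner[OF g] algebra_simps)
  finally show "?l \<bullet> v = ?r \<bullet> v" .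
qed

lemma dual_point_in_projective_space:
  "affine_plane H \<Longrightarrow> dual_point H \<in> projective_space"
  using bij_betw_dual_point bij_betwE by blast

lemma dual_point_affine_action:
  assumes g: "invertible (fst g)" and H: "affine_plane H"
  shows "dual_action g (dual_point H) = dual_point (affine_action g ` H)"
proof -
  let ?F = "affine_matrix g" and ?M = "contragredient (affine_matrix g)"
  have inv: "invertible ?F" using g by (rule invertible_affine_matrix)
  have act: "homog (affine_action g Y) 1 = ?F *v homog Y 1" for Y
    by (simp add: affine_matrix_homog affine_action_def)
  have mem: "?M *v u \<in> dual_point (affine_action g ` H) \<longleftrightarrow> u \<in> dual_point H" for u
    by (simp add: dual_point_def act contragredient_inner[OF inv])
  have "dual_point (affine_action g ` H) = (*v) ?M ` dual_point H"
  proof (intro equalityI subsetI)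
    fix u assume u: "u \<in> dual_point (affine_action g ` H)"
    have "u = ?M *v (matrix_inv ?M *v u)"
      by (simp add: matrix_vector_mul_assoc matrix_inv[OF invertible_contragredient[OF inv]])
    then show "u \<in> (*v) ?M ` dual_point H" using mem u by (metis imageI)
  qed (use mem in auto)
  then show ?thesis
    using dual_point_in_projective_space[OF H] by (simp add: dual_action_def proj_map_def)
qed

lemma Aut_semidirect_carrier:
  "g \<in> carrier (Aut_semidirect C) \<longleftrightarrow> det (fst g) = 1 \<and> (*v) (fst g) ` C = C"
  by (cases g) (simp add: Aut_semidirect_def Aut_cone_def)

lemma Aut_semidirect_invertible:
  "g \<in> carrier (Aut_semidirect C) \<Longrightarrow> invertible (fst g)"
  by (simp add: Aut_semidirect_carrier invertible_det_nz)

lemma affine_action_spacelike: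
  assumes C: "proper_convex_cone C" and g: "g \<in> carrier (Aut_semidirect C)"
    and H: "H \<in> spacelike_planes C"
  shows "affine_action g ` H \<in> spacelike_planes C"
proof -
  have inv: "invertible (fst g)" using g by (rule Aut_semidirect_invertible)
  let ?A' = "contragredient (fst g)"
  obtain a b where a: "a \<in> dual_cone C" "H = {Y. a \<bullet> Y = b}" using spacelike_plane_cases[OF C H] .
  have "affine_action g ` H = {Y. (?A' *v a) \<bullet> Y = b + (?A' *v a) \<bullet> snd g}"
  proof (intro equalityI subsetI)
    fix Y assume Y: "Y \<in> {Y. (?A' *v a) \<bullet> Y = b + (?A' *v a) \<bullet> snd g}"
    define Z where "Z = matrix_inv (fst g) *v (Y - snd g)"
    have YZ: "Y = affine_action g Z"
      by (simp add: Z_def affine_action_def matrix_vector_mul_assoc matrix_inv[OF inv])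
    then have "Z \<in> H" using Y by (simp add: a affine_action_def inner_add_right contragredient_inner[OF inv])
    then show "Y \<in> affine_action g ` H" using YZ by blast
  qed (auto simp: a affine_action_def inner_add_right contragredient_inner[OF inv])
  moreover have "?A' *v a \<in> dual_cone C"
    using g a Aut_cone_dual[OF C inv] by (auto simp: Aut_semidirect_carrier)
  ultimately show ?thesis using spacelike_planeI[OF C] by simp
qed

lemma dual_action_span:
  assumes "invertible (fst g)" "a \<noteq> 0"
  shows "dual_action g (span {homog a s}) =
    span {homog (contragredient (fst g) *v a) (s - (contragredient (fst g) *v a) \<bullet> snd g)}"
  by (simp add: dual_action_def proj_map_span homog_nonzero assms contragredient_affine_matrix)

lemma dual_action_dual_tube:
  assumes C: "proper_convex_cone C" and g: "g \<in> carrier (Aut_semidirect C)"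
  shows "dual_action g ` dual_tube C = dual_tube C"
proof -
  have inv: "invertible (fst g)" using g by (rule Aut_semidirect_invertible)
  have img: "(*v) (contragredient (fst g)) ` dual_cone C = dual_cone C"
    using g Aut_cone_dual[OF C inv] by (simp add: Aut_semidirect_carrier)
  have act: "dual_action g (span {homog a s}) =
    span {homog (contragredient (fst g) *v a) (s - (contragredient (fst g) *v a) \<bullet> snd g)}"
    if "a \<in> dual_cone C" for a s
    using that zero_notin_dual_cone[OF C] by (intro dual_action_span inv) blast
  show ?thesis
  proof (intro equalityI subsetI)
    fix l assume "l \<in> dual_action g ` dual_tube C"
    then obtain a s where as: "a \<in> dual_cone C" "l = dual_action g (span {homog a s})"
      by (auto simp: dual_tube_def)
    moreover have "contragredient (fst g) *v a \<in> dual_cone C" using img as by blast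
    ultimately show "l \<in> dual_tube C" unfolding dual_tube_def using act by blast
  next
    fix l assume "l \<in> dual_tube C"
    then obtain b t where b: "b \<in> dual_cone C" "l = span {homog b t}" by (auto simp: dual_tube_def)
    then obtain a where a: "a \<in> dual_cone C" "b = contragredient (fst g) *v a" using img by blast
    then have "l = dual_action g (span {homog a (t + b \<bullet> snd g)})" using act b by simp
    then show "l \<in> dual_action g ` dual_tube C" using a by (auto simp: dual_tube_def)
  qed
qed

section \<open>Automorphisms of the tube\<close>

text \<open>
  The orientation conditions without reference to coordinates. For \<open>a\<close> in the section, the third
  homogeneous coordinate of the image of the corresponding planar point is the value at \<open>w\<close> of the
  image of \<open>a\<close>; the constant \<open>k\<close> of the frame cancels.
\<close>

lemma preserves_dual_tube_orientations_iff:
  assumes C: "proper_convex_cone C" and w: "w \<in> C"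
    and coords: "tube_coordinates (dual_hyperplane (span {w})) dual_point_infinity (dual_tube C) N \<Omega>"
    and Mc: "M *v homog 0 1 = homog 0 1"
  shows "preserves_tube_orientations N \<Omega> (proj_map M) \<longleftrightarrow>
    det M > 0 \<and> (\<forall>a \<in> dual_cone C. w \<bullet> a = 1 \<longrightarrow> homog w 0 \<bullet> (M *v homog a 0) > 0)"
proof -
  have N: "invertible N" and \<Omega>: "open \<Omega>" "\<Omega> \<noteq> {}"
    using coords by (simp_all add: tube_coordinates_def polarized_coordinates_def)
  obtain k c where k: "k \<noteq> 0" and c3: "N *v axis 3 1 = homog 0 c"
    and P: "invertible (base_frame N)" and wP: "\<forall>v. w \<bullet> (base_frame N *v v) = k * v $ 3"
    and \<Sigma>: "{a \<in> dual_cone C. w \<bullet> a = 1} = (\<lambda>x. (1 / k) *\<^sub>R (base_frame N *v affine_coord_vector x)) ` \<Omega>"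
    using tube_coordinates_dual_tube[OF C w coords] .
  define K where "K = matrix_inv N ** M ** N"
  have MN: "M ** N = N ** K"
    by (simp add: K_def matrix_mul_assoc matrix_inv[OF N])
  have M0: "M *v homog 0 t = homog 0 t" for t
    using Mc matrix_vector_mult_scaleR[of M t "homog 0 1"] by (simp add: homog_scaleR)
  have "K *v axis 3 1 = matrix_inv N *v (M *v (N *v axis 3 1))"
    by (simp add: K_def matrix_vector_mul_assoc matrix_mul_assoc)
  also have "\<dots> = matrix_inv N *v (N *v axis 3 1)" by (simp add: c3 M0)
  finally have K: "K *v axis 3 1 = 1 *\<^sub>R axis 3 1"
    by (simp add: matrix_vector_mul_assoc matrix_inv[OF N])
  have height: "(quotient_block K *v affine_coord_vector x) $ 3 =
      homog w 0 \<bullet> (M *v homog ((1 / k) *\<^sub>R (base_frame N *v affine_coord_vector x)) 0)" for x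
  proof -
    let ?P = "base_frame N" and ?G = "quotient_block K" and ?x = "affine_coord_vector x"
    obtain s where s: "N *v lift ?x 0 = homog (?P *v ?x) s"
      using vertical_frame_block(1)[OF c3] by blast
    obtain z where z: "K *v lift ?x 0 = lift (?G *v ?x) z"
      using vertical_eigenvector_block(1)[OF K] by blast
    obtain t where t: "N *v lift (?G *v ?x) z = homog (?P *v (?G *v ?x)) t"
      using vertical_frame_block(1)[OF c3] by blast
    have "homog (?P *v ?x) s = k *\<^sub>R homog ((1 / k) *\<^sub>R (?P *v ?x)) 0 + homog 0 s"
      using k by (simp add: homog_scaleR homog_add)
    then have "M *v (N *v lift ?x 0) = k *\<^sub>R (M *v homog ((1 / k) *\<^sub>R (?P *v ?x)) 0) + homog 0 s"
      by (simp add: s matrix_vector_right_distrib matrix_vector_mult_scaleR M0)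
    moreover have "M *v (N *v lift ?x 0) = homog (?P *v (?G *v ?x)) t"
      using MN by (metis matrix_vector_mul_assoc z t)
    ultimately have "homog w 0 \<bullet> homog (?P *v (?G *v ?x)) t =
        homog w 0 \<bullet> (k *\<^sub>R (M *v homog ((1 / k) *\<^sub>R (?P *v ?x)) 0) + homog 0 s)" by simp
    then have "k * (?G *v ?x) $ 3 = k * (homog w 0 \<bullet> (M *v homog ((1 / k) *\<^sub>R (?P *v ?x)) 0))"
      by (simp add: homog_inner wP inner_add_right)
    then show ?thesis using k by simp
  qed
  have "(\<forall>a \<in> dual_cone C. w \<bullet> a = 1 \<longrightarrow> homog w 0 \<bullet> (M *v homog a 0) > 0) \<longleftrightarrow>
      (\<forall>a \<in> {a \<in> dual_cone C. w \<bullet> a = 1}. homog w 0 \<bullet> (M *v homog a 0) > 0)" by blast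
  also have "\<dots> \<longleftrightarrow> (\<forall>x\<in>\<Omega>. 1 * (quotient_block K *v affine_coord_vector x) $ 3 > 0)"
    unfolding \<Sigma> height by simp
  finally show ?thesis using preserves_tube_orientations_iff[OF N MN K \<Omega>] by simp
qed

text \<open>
  The contragredient of the affine matrix has determinant \<open>1\<close> and fixes \<open>homog 0 1\<close>, and the images of
  elements of the dual cone stay in the dual cone, where \<open>w\<close> is positive.
\<close>

lemma dual_action_automorphism:
  assumes C: "proper_convex_cone C" and w: "w \<in> C" and g: "g \<in> carrier (Aut_semidirect C)"
  shows "tube_automorphism (dual_hyperplane (span {w})) dual_point_infinity (dual_tube C) (dual_action g)"
proof -
  have inv: "invertible (fst g)" using g by (rule Aut_semidirect_invertible)
  define M where "M = contragredient (affine_matrix g)"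
  have Minv: "invertible M"
    unfolding M_def by (intro invertible_contragredient invertible_affine_matrix inv)
  have det: "det M = 1"
    using det_contragredient[OF invertible_affine_matrix[OF inv]] g
    by (simp add: M_def det_affine_matrix Aut_semidirect_carrier)
  have Mc: "M *v homog 0 1 = homog 0 1"
    by (simp add: M_def contragredient_affine_matrix[OF inv])
  have \<Phi>: "dual_action g = proj_map M" by (simp add: dual_action_def M_def)
  obtain N \<Omega> where coords:
      "tube_coordinates (dual_hyperplane (span {w})) dual_point_infinity (dual_tube C) N \<Omega>"
    using convex_tube_domain_dual_tube[OF C w] by (auto simp: convex_tube_domain_def)
  have pos: "homog w 0 \<bullet> (M *v homog a 0) > 0" if a: "a \<in> dual_cone C" for a
  proof -
    have "contragredient (fst g) *v a \<in> dual_cone C"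
      using g a Aut_cone_dual[OF C inv] by (auto simp: Aut_semidirect_carrier)
    then show ?thesis
      using dual_cone_pos[OF C _ w] by (simp add: M_def contragredient_affine_matrix[OF inv] homog_inner)
  qed
  have "preserves_tube_orientations N \<Omega> (dual_action g)"
    unfolding \<Phi> using preserves_dual_tube_orientations_iff[OF C w coords Mc] det pos by simp
  moreover have "unit_eigenvalue_at dual_point_infinity (dual_action g)"
    unfolding unit_eigenvalue_at_def
    by (rule exI[of _ M])
      (use det Mc in \<open>auto simp: \<Phi> dual_point_infinity_eq span_singleton matrix_vector_mult_scaleR
         intro!: exI[of _ "1::real"]\<close>)
  moreover have "dual_action g \<in> homographies" using Minv by (auto simp: \<Phi> homographies_def)
  ultimately show ?thesis
    unfolding tube_automorphism_def using dual_action_dual_tube[OF C g] coords by blast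
qed

text \<open>
  The eigenvalue condition provides a representative \<open>M\<close> that fixes \<open>homog 0 1\<close>, so its contragredient
  preserves the last coordinate and comes from an affine map. Invariance of the tube and preservation
  of orientation put its linear part in \<open>Aut_cone C\<close>.
\<close>

lemma tube_automorphism_is_dual_action:
  assumes C: "proper_convex_cone C" and w: "w \<in> C"
    and \<Phi>: "tube_automorphism (dual_hyperplane (span {w})) dual_point_infinity (dual_tube C) \<Phi>"
  shows "\<exists>g \<in> carrier (Aut_semidirect C). \<Phi> = dual_action g"
proof -
  obtain N \<Omega> where coords:
      "tube_coordinates (dual_hyperplane (span {w})) dual_point_infinity (dual_tube C) N \<Omega>"
    and orient: "preserves_tube_orientations N \<Omega> \<Phi>"
    using \<Phi> unfolding tube_automorphism_def by blast
  have T: "\<Phi> ` dual_tube C = dual_tube C" using \<Phi> by (simp add: tube_automorphism_def)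
  obtain M0 c where M0: "\<bar>det M0\<bar> = 1" "\<Phi> = proj_map M0" "\<bar>c\<bar> = 1"
      "\<forall>u\<in>dual_point_infinity. M0 *v u = c *\<^sub>R u"
    using \<Phi> unfolding tube_automorphism_def unit_eigenvalue_at_def by blast
  \<comment> \<open>As \<open>c\<close> is a sign, this is the other representative when \<open>c = - 1\<close>; in both cases its vertical
     eigenvalue is \<open>c * c = 1\<close>.\<close>
  define M where "M = c *\<^sub>R M0"
  have cc: "c * c = 1" using M0(3) by (metis abs_mult_self_eq mult_1)
  then have "c \<noteq> 0" by auto
  have \<Phi>M: "\<Phi> = proj_map M" by (simp add: M_def M0(2) proj_map_scaleR[OF \<open>c \<noteq> 0\<close>])
  have "M *v homog 0 1 = c *\<^sub>R (M0 *v homog 0 1)" by (simp add: M_def scaleR_matrix_vector_assoc)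
  also have "M0 *v homog 0 1 = c *\<^sub>R homog 0 1" using M0(4) by (simp add: dual_point_infinity_eq span_base)
  finally have Mc: "M *v homog 0 1 = homog 0 1" by (simp add: cc)
  have absdet: "\<bar>det M\<bar> = 1"
    using M0(1,3) by (simp add: M_def det_scaleR_4 abs_mult power_abs)
  then have Minv: "invertible M" by (auto simp: invertible_det_nz)
  from orient have det0: "det M > 0"
    and pos: "\<And>a. a \<in> dual_cone C \<Longrightarrow> w \<bullet> a = 1 \<Longrightarrow> homog w 0 \<bullet> (M *v homog a 0) > 0"
    unfolding \<Phi>M preserves_dual_tube_orientations_iff[OF C w coords Mc] by blast+
  have det: "det M = 1" using absdet det0 by simp
  have "(contragredient M *v v) $ 4 = v $ 4" for v
  proof -
    have last: "homog 0 1 \<bullet> u = u $ 4" for u by (simp add: homog_def inner_vec_def sum_4 vector_4)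
    have "homog 0 1 \<bullet> (contragredient M *v v) = (M *v homog 0 1) \<bullet> (contragredient M *v v)" by (simp add: Mc)
    also have "\<dots> = homog 0 1 \<bullet> v" using contragredient_inner[OF Minv] by (metis inner_commute)
    finally show ?thesis by (simp add: last)
  qed
  then obtain g where gF: "contragredient M = affine_matrix g" using affine_matrix_cases by blast
  have M_eq: "M = contragredient (affine_matrix g)"
    using contragredient_contragredient[OF Minv] gF by simp
  have detg: "det (fst g) = 1"
    using det_contragredient[OF Minv] det gF by (simp add: det_affine_matrix)
  then have inv: "invertible (fst g)" by (simp add: invertible_det_nz)
  have \<Phi>g: "\<Phi> = dual_action g" by (simp add: \<Phi>M M_eq dual_action_def)
  define A' where "A' = contragredient (fst g)"
  have act: "\<exists>t. \<Phi> (span {homog a s}) = span {homog (A' *v a) t}" if "a \<in> dual_cone C" for a s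
    using that zero_notin_dual_cone[OF C] dual_action_span[OF inv, of a s]
    by (metis \<Phi>g A'_def)
  have wpos: "w \<bullet> (A' *v a) > 0" if a: "a \<in> dual_cone C" for a
  proof -
    have wa: "w \<bullet> a > 0" using dual_cone_pos[OF C a w] .
    then have "w \<bullet> (A' *v ((1 / (w \<bullet> a)) *\<^sub>R a)) > 0"
      using pos[of "(1 / (w \<bullet> a)) *\<^sub>R a"] dual_cone_scale[OF a]
      by (simp add: M_eq contragredient_affine_matrix[OF inv] homog_inner A'_def)
    then show ?thesis using wa by (simp add: matrix_vector_mult_scaleR zero_less_divide_iff)
  qed
  have "(*v) A' ` dual_cone C = dual_cone C"
  proof (intro equalityI subsetI)
    fix b assume "b \<in> (*v) A' ` dual_cone C"
    then obtain a where a: "a \<in> dual_cone C" "b = A' *v a" by blast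
    obtain t where "\<Phi> (span {homog a 0}) = span {homog b t}" using act[OF a(1)] a(2) by blast
    moreover have "span {homog a 0} \<in> dual_tube C" using a by (auto simp: dual_tube_def)
    ultimately have "span {homog b t} \<in> dual_tube C" using T by (metis imageI)
    then show "b \<in> dual_cone C" using span_homog_in_dual_tube[OF C w] wpos a by simp
  next
    fix b assume b: "b \<in> dual_cone C"
    then have "span {homog b 0} \<in> \<Phi> ` dual_tube C" unfolding T by (auto simp: dual_tube_def)
    then obtain a s where a: "a \<in> dual_cone C" "span {homog b 0} = \<Phi> (span {homog a s})"
      by (auto simp: dual_tube_def)
    then obtain t where "span {homog b 0} = span {homog (A' *v a) t}" using act by metis
    moreover have "homog b 0 \<noteq> 0" using b zero_notin_dual_cone[OF C] by (intro homog_nonzero) auto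
    ultimately obtain r where "homog b 0 = r *\<^sub>R homog (A' *v a) t" using span_singleton_eqD by metis
    then have br: "b = r *\<^sub>R (A' *v a)" by (simp add: homog_scaleR homog_eq_iff)
    then have "r > 0" using dual_cone_pos[OF C b w] wpos[OF a(1)] by (simp add: zero_less_mult_iff)
    then show "b \<in> (*v) A' ` dual_cone C"
      using br dual_cone_scale[OF a(1)] by (auto simp flip: matrix_vector_mult_scaleR)
  qed
  then have "g \<in> carrier (Aut_semidirect C)"
    using detg Aut_cone_dual[OF C inv] by (simp add: Aut_semidirect_carrier A'_def)
  then show ?thesis using \<Phi>g by blast
qed

text \<open>
  Surjectivity is the classification of tube automorphisms. Injectivity holds because the
  representatives chosen by \<open>dual_action\<close> all fix \<open>homog 0 1\<close>.
\<close>

lemma dual_action_iso: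
  assumes C: "proper_convex_cone C" and w: "w \<in> C"
  shows "dual_action \<in> iso (Aut_semidirect C)
    (Aut_tube (dual_hyperplane (span {w})) dual_point_infinity (dual_tube C))"
    (is "_ \<in> iso ?G ?T")
proof (rule isoI)
  have carrier: "carrier ?T = dual_action ` carrier ?G"
  proof -
    have "carrier ?T = {\<Phi>. tube_automorphism (dual_hyperplane (span {w})) dual_point_infinity (dual_tube C) \<Phi>}"
      by (simp add: Aut_tube_def)
    then show ?thesis
      using dual_action_automorphism[OF C w] tube_automorphism_is_dual_action[OF C w] by blast
  qed
  have inv: "invertible (affine_matrix g)" "invertible (contragredient (affine_matrix g))"
    if "g \<in> carrier ?G" for g
    using that by (simp_all add: Aut_semidirect_invertible invertible_affine_matrix invertible_contragredient)
  show "dual_action \<in> hom ?G ?T"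
  proof (rule homI)
    fix g h assume g: "g \<in> carrier ?G" and h: "h \<in> carrier ?G"
    have "dual_action g \<in> Bij projective_space" "dual_action h \<in> Bij projective_space"
      using inv[OF g] inv[OF h] homographies_subset_Bij by (auto simp: dual_action_def homographies_def)
    moreover have "dual_action (g \<otimes>\<^bsub>?G\<^esub> h) = compose projective_space (dual_action g) (dual_action h)"
      using inv[OF g] inv[OF h]
      by (simp add: Aut_semidirect_def affine_matrix_mult dual_action_def contragredient_mult proj_map_mult)
    ultimately show "dual_action (g \<otimes>\<^bsub>?G\<^esub> h) = dual_action g \<otimes>\<^bsub>?T\<^esub> dual_action h"
      by (simp add: Aut_tube_def BijGroup_def)
  qed (use carrier in blast)
  show "bij_betw dual_action (carrier ?G) (carrier ?T)"
    unfolding carrier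
  proof (rule inj_on_imp_bij_betw, rule inj_onI)
    fix g h assume g: "g \<in> carrier ?G" and h: "h \<in> carrier ?G" and eq: "dual_action g = dual_action h"
    have "contragredient (affine_matrix g) = contragredient (affine_matrix h)"
    proof (rule proj_map_inj_fixed_vector)
      show "proj_map (contragredient (affine_matrix g)) = proj_map (contragredient (affine_matrix h))"
        using eq by (simp add: dual_action_def)
      show "homog 0 1 \<noteq> 0" by (metis homog_0 homog_eq_iff zero_neq_one)
    qed (use g h inv in \<open>simp_all add: contragredient_affine_matrix Aut_semidirect_invertible\<close>)
    then have "affine_matrix g = affine_matrix h"
      using contragredient_contragredient inv g h by metis
    then show "g = h" by (rule affine_matrix_inj)
  qed
qed

theorem proposition5:
  fixes p :: "(real^3) set" and C :: "(real^3) set"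
  assumes "p \<in> projective_space"
    and "proper_convex_cone C"
    and "p \<in> projectivization C"
  shows
    "spacelike_planes C \<subseteq> dual_affine_space p \<and>
     convex_tube_domain (dual_hyperplane p) dual_point_infinity (dual_point ` spacelike_planes C) \<and>
     (\<forall>N \<Omega>. tube_coordinates (dual_hyperplane p) dual_point_infinity
               (dual_point ` spacelike_planes C) N \<Omega> \<longrightarrow>
        (\<exists>\<Sigma> L. section_of (dual_cone C) \<Sigma> \<and> L \<in> homographies \<and>
           L ` projectivization \<Sigma> = planar_point ` \<Omega> \<and>
           (\<forall>H \<in> spacelike_planes C. \<forall>a \<in> \<Sigma>. \<forall>x z.
              direction H = {v. a \<bullet> v = 0} \<and> dual_point H = affine_param N x z \<longrightarrow>
              L (span {a}) = planar_point x))) \<and>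
     (\<exists>\<phi> \<in> iso (Aut_semidirect C)
               (Aut_tube (dual_hyperplane p) dual_point_infinity (dual_point ` spacelike_planes C)).
        \<forall>g \<in> carrier (Aut_semidirect C). \<forall>H \<in> spacelike_planes C.
          affine_action g ` H \<in> spacelike_planes C \<and>
          \<phi> g (dual_point H) = dual_point (affine_action g ` H))"
proof -
  note C = assms(2)
  obtain w where w: "w \<in> C" "p = span {w}" using assms(3) by (auto simp: projectivization_def)
  have chart: "H \<in> dual_affine_space p" if H: "H \<in> spacelike_planes C" for H
  proof -
    obtain a b where a: "a \<in> dual_cone C" "H = {Y. a \<bullet> Y = b}" using spacelike_plane_cases[OF C H] .
    have a0: "a \<noteq> 0" using zero_notin_dual_cone[OF C] a by blast
    have "w \<bullet> a > 0" using dual_cone_pos[OF C a(1) w(1)] .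
    then have "w \<notin> direction H" unfolding a(2) direction_plane[OF a0] by (simp add: inner_commute)
    moreover have "w \<in> p" by (simp add: w(2) span_base)
    ultimately show ?thesis using H by (auto simp: dual_affine_space_def spacelike_planes_def)
  qed
  have equivariant: "affine_action g ` H \<in> spacelike_planes C \<and>
      dual_action g (dual_point H) = dual_point (affine_action g ` H)"
    if "g \<in> carrier (Aut_semidirect C)" "H \<in> spacelike_planes C" for g H
    using affine_action_spacelike[OF C that] dual_point_affine_action[of g H] that
    by (simp add: Aut_semidirect_invertible spacelike_planes_def)
  show ?thesis
    unfolding dual_points_spacelike[OF C] w(2)
  proof (intro conjI)
    show "spacelike_planes C \<subseteq> dual_affine_space (span {w})" using chart w(2) by blast
    show "\<exists>\<phi>\<in>iso (Aut_semidirect C)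
        (Aut_tube (dual_hyperplane (span {w})) dual_point_infinity (dual_tube C)).
        \<forall>g\<in>carrier (Aut_semidirect C). \<forall>H\<in>spacelike_planes C.
          affine_action g ` H \<in> spacelike_planes C \<and>
          \<phi> g (dual_point H) = dual_point (affine_action g ` H)"
      by (rule bexI[OF _ dual_action_iso[OF C w(1)]]) (intro ballI equivariant)
  qed (intro allI impI convex_tube_domain_dual_tube[OF C w(1)] dual_tube_base_is_section[OF C w(1)])+
qed

end
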